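(* Let $(P_n)_{n\ge1}$ be a sequence of probability measures on $(D,\mathcal D)$, where $D=D[0,1]$ carries the Skorokhod topology and $\mathcal D$ is its Borel $\sigma$-algebra. The sequence $(P_n)$ is tight if and only if the following two conditions hold: (i) $\lim_{a\to\infty}\limsup_{n\to\infty}P_n(x:\|x\|\ge a)=0$; (ii) $\lim_{\delta\to0}\limsup_{n\to\infty}P_n(x:w'_x(\delta)\ge\epsilon)=0$ for each $\epsilon>0$. Moreover, condition (ii) is equivalent to (ii$'$) for all $\epsilon,\eta>0$ there exist $\delta\in(0,1)$ and $n_0>0$ such that $P_n(x:w'_x(\delta)\ge\epsilon)\le\eta$ for all $n>n_0$.
   Context: $D=D[0,1]$ is the space of functions $x:[0,1]\to\mathbb R$ that are right continuous and have left-hand limits; $\|x\|=\sup_{0\le t\le1}|x(t)|$. Let $\Lambda$ be the class of strictly increasing continuous maps $\lambda:[0,1]\to[0,1]$ with $\lambda 0=0$, $\lambda1=1$. The Skorokhod topology on $D$ is the one generated by the metric $d(x,y)=\inf_{\lambda\in\Lambda}\{\sup_t|\lambda t-t|\vee\|x-y\circ\lambda\|\}$. For $\delta\in(0,1)$, a set $0=t_0<t_1<\ldots<t_v=1$ is $\delta$-sparse if $t_i-t_{i-1}>\delta$ for $i=1,\ldots,v$. The cadlag modulus is $w'_x(\delta)=\inf_{\{t_i\}}\max_{1\le i\le v}\sup_{s,t\in[t_{i-1},t_i)}|x(t)-x(s)|$, the infimum being over all $\delta$-sparse sets $\{t_i\}$. A sequence $(P_n)$ is tight if for every $\epsilon>0$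 there is a compact set $K\subset D$ with $P_n(K)>1-\epsilon$ for all $n$. *)

theory Defs
  imports "HOL-Probability.Probability"
begin

text \<open>
  The space \<open>D[0,1]\<close> as a type. Paths are total functions on the reals, so they are required to be
  \<^const>\<open>undefined\<close> outside the unit interval; two elements are then equal iff they agree on \<open>[0,1]\<close>.
  The one-sided limits at points of \<open>[0,1)\<close>, resp. \<open>(0,1]\<close>, only involve values inside \<open>[0,1]\<close>.
\<close>

definition cadlag_on_unit :: "(real \<Rightarrow> real) \<Rightarrow> bool" where
  "cadlag_on_unit x \<longleftrightarrow>
     (\<forall>t\<in>{0..<1}. (x \<longlongrightarrow> x t) (at_right t)) \<and>
     (\<forall>t\<in>{0<..1}. \<exists>l. (x \<longlongrightarrow> l) (at_left t))"

typedef cadlag = "{x \<in> extensional {0..1::real}. cadlag_on_unit x}"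
  morphisms cadlag_fun Abs_cadlag
proof
  show "restrict (\<lambda>_. 0) {0..1} \<in> {x \<in> extensional {0..1::real}. cadlag_on_unit x}"
  proof (simp add: cadlag_on_unit_def, intro conjI ballI)
    fix t :: real assume t: "t \<in> {0..<1}"
    have "eventually (\<lambda>u. restrict (\<lambda>_. 0) {0..1} u = (0::real)) (at_right t)"
      using t unfolding eventually_at_right_field by (auto intro!: exI[of _ 1])
    then show "(restrict (\<lambda>_. 0) {0..1} \<longlongrightarrow> (0::real)) (at_right t)"
      by (rule tendsto_eventually)
  next
    fix t :: real assume t: "t \<in> {0<..1}"
    have "eventually (\<lambda>u. restrict (\<lambda>_. 0) {0..1} u = (0::real)) (at_left t)"
      using t unfolding eventually_at_left_field by (auto intro!: exI[of _ 0])
    then show "\<exists>l. (restrict (\<lambda>_. 0) {0..1} \<longlongrightarrow> (l::real)) (at_left t)"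
      using tendsto_eventually by blast
  qed
qed

definition sup_norm :: "cadlag \<Rightarrow> real" where
  "sup_norm x = (SUP t\<in>{0..1}. \<bar>cadlag_fun x t\<bar>)"

definition time_changes :: "(real \<Rightarrow> real) set" where
  "time_changes = {\<phi>. \<phi> \<in> {0..1} \<rightarrow> {0..1} \<and> strict_mono_on {0..1} \<phi> \<and>
     continuous_on {0..1} \<phi> \<and> \<phi> 0 = 0 \<and> \<phi> 1 = 1}"

definition skorokhod_cost :: "cadlag \<Rightarrow> cadlag \<Rightarrow> (real \<Rightarrow> real) \<Rightarrow> real" where
  "skorokhod_cost x y \<phi> =
     max (SUP t\<in>{0..1}. \<bar>\<phi> t - t\<bar>) (SUP t\<in>{0..1}. \<bar>cadlag_fun x t - cadlag_fun y (\<phi> t)\<bar>)"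

text \<open>
  Cadlag paths are bounded on \<open>[0,1]\<close>, so the real-valued suprema here, in the Skorokhod metric and
  in the modulus are genuine suprema.
\<close>

lemma cadlag_right: "0 \<le> t \<Longrightarrow> t < 1 \<Longrightarrow> (cadlag_fun x \<longlongrightarrow> cadlag_fun x t) (at_right t)"
  using cadlag_fun[of x] by (auto simp: cadlag_on_unit_def)

lemma cadlag_left: "0 < t \<Longrightarrow> t \<le> 1 \<Longrightarrow> \<exists>l. (cadlag_fun x \<longlongrightarrow> l) (at_left t)"
  using cadlag_fun[of x] by (auto simp: cadlag_on_unit_def)

lemma cadlag_locally_bounded:
  assumes "t \<in> {0..1}"
  shows "\<exists>U. open U \<and> t \<in> U \<and> (\<exists>B. \<forall>u\<in>U \<inter> {0..1}. \<bar>cadlag_fun x u\<bar> \<le> B)"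
proof -
  have ev: "\<exists>B. eventually (\<lambda>u. \<bar>cadlag_fun x u\<bar> \<le> B) F" if "(cadlag_fun x \<longlongrightarrow> l) F" for l F
  proof -
    have "eventually (\<lambda>u. dist (cadlag_fun x u) l < 1) F"
      using that by (rule tendstoD) simp
    then have "eventually (\<lambda>u. \<bar>cadlag_fun x u\<bar> \<le> \<bar>l\<bar> + 1) F"
      by (rule eventually_mono) (auto simp: dist_real_def)
    then show ?thesis by blast
  qed
  have "\<exists>b>t. \<exists>B. \<forall>u. t < u \<and> u < b \<and> u \<le> 1 \<longrightarrow> \<bar>cadlag_fun x u\<bar> \<le> B"
  proof (cases "t < 1")
    case True
    then obtain B where "eventually (\<lambda>u. \<bar>cadlag_fun x u\<bar> \<le> B) (at_right t)"
      using ev cadlag_right[of t x] assms by fastforce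
    then show ?thesis unfolding eventually_at_right_field by blast
  next
    case False
    then show ?thesis using assms by (intro exI[of _ "t + 1"]) auto
  qed
  then obtain b B where b: "b > t" "\<And>u. t < u \<Longrightarrow> u < b \<Longrightarrow> u \<le> 1 \<Longrightarrow> \<bar>cadlag_fun x u\<bar> \<le> B"
    by blast
  have "\<exists>a<t. \<exists>A. \<forall>u. a < u \<and> u < t \<and> 0 \<le> u \<longrightarrow> \<bar>cadlag_fun x u\<bar> \<le> A"
  proof (cases "0 < t")
    case True
    then obtain l where "(cadlag_fun x \<longlongrightarrow> l) (at_left t)"
      using cadlag_left[of t x] assms by auto
    then obtain A where "eventually (\<lambda>u. \<bar>cadlag_fun x u\<bar> \<le> A) (at_left t)"
      using ev by blast
    then show ?thesis unfolding eventually_at_left_field by blast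
  next
    case False
    then show ?thesis using assms by (intro exI[of _ "t - 1"]) auto
  qed
  then obtain a A where a: "a < t" "\<And>u. a < u \<Longrightarrow> u < t \<Longrightarrow> 0 \<le> u \<Longrightarrow> \<bar>cadlag_fun x u\<bar> \<le> A"
    by blast
  have "\<bar>cadlag_fun x u\<bar> \<le> max (max A B) \<bar>cadlag_fun x t\<bar>" if "u \<in> {a<..<b} \<inter> {0..1}" for u
    using that a(2)[of u] b(2)[of u] by (cases u t rule: linorder_cases) auto
  then have "\<exists>B. \<forall>u\<in>{a<..<b} \<inter> {0..1}. \<bar>cadlag_fun x u\<bar> \<le> B" by blast
  then show ?thesis
    using a(1) b(1) by (intro exI[of _ "{a<..<b}"]) simp
qed

lemma cadlag_bounded: "\<exists>B. \<forall>t\<in>{0..1}. \<bar>cadlag_fun x t\<bar> \<le> B"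
proof -
  obtain U where U: "\<And>t. t \<in> {0..1} \<Longrightarrow> open (U t)" "\<And>t. t \<in> {0..1} \<Longrightarrow> t \<in> U t"
    "\<And>t. t \<in> {0..1} \<Longrightarrow> \<exists>B. \<forall>u\<in>U t \<inter> {0..1}. \<bar>cadlag_fun x u\<bar> \<le> B"
    using cadlag_locally_bounded[of _ x] by metis
  obtain B where B: "\<And>t u. t \<in> {0..1} \<Longrightarrow> u \<in> U t \<inter> {0..1} \<Longrightarrow> \<bar>cadlag_fun x u\<bar> \<le> B t"
    using U(3) by metis
  have "{0..1::real} \<subseteq> (\<Union>t\<in>{0..1}. U t)" using U(2) by blast
  then obtain C where C: "C \<subseteq> {0..1}" "finite C" "{0..1::real} \<subseteq> (\<Union>t\<in>C. U t)"
    using compactE_image[of "{0..1::real}" "{0..1}" U] U(1) by auto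
  have "\<bar>cadlag_fun x u\<bar> \<le> Max (B ` C)" if u: "u \<in> {0..1}" for u
  proof -
    obtain t where t: "t \<in> C" "u \<in> U t" using C(3) u by blast
    then have "\<bar>cadlag_fun x u\<bar> \<le> B t" using B[of t u] C(1) u by auto
    also have "\<dots> \<le> Max (B ` C)" using t C(2) by simp
    finally show ?thesis .
  qed
  then show ?thesis by blast
qed

lemma time_changes_id: "(\<lambda>t. t) \<in> time_changes"
  by (auto simp: time_changes_def strict_mono_on_def)

lemma time_changes_compose:
  assumes "\<phi> \<in> time_changes" "\<psi> \<in> time_changes"
  shows "\<psi> \<circ> \<phi> \<in> time_changes"
proof -
  have "continuous_on {0..1} (\<psi> \<circ> \<phi>)"
    using assms unfolding time_changes_def
    by (intro continuous_on_compose) (auto intro: continuous_on_subset[of "{0..1}"])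
  then show ?thesis
    using assms unfolding time_changes_def strict_mono_on_def Pi_def by (simp add: comp_def)
qed

lemma time_changes_bij:
  assumes "\<phi> \<in> time_changes"
  shows "bij_betw \<phi> {0..1} {0..1}"
  unfolding bij_betw_def
proof
  show "inj_on \<phi> {0..1}"
    using assms by (auto simp: time_changes_def intro: strict_mono_on_imp_inj_on)
  show "\<phi> ` {0..1} = {0..1}"
  proof
    show "\<phi> ` {0..1} \<subseteq> {0..1}" using assms by (auto simp: time_changes_def)
    show "{0..1} \<subseteq> \<phi> ` {0..1}"
    proof
      fix y :: real assume "y \<in> {0..1}"
      then have "\<exists>t\<ge>0. t \<le> 1 \<and> \<phi> t = y"
        using assms by (intro IVT') (auto simp: time_changes_def)
      then show "y \<in> \<phi> ` {0..1}" by auto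
    qed
  qed
qed

lemma time_changes_inverse:
  assumes l: "\<phi> \<in> time_changes"
  shows "inv_into {0..1} \<phi> \<in> time_changes"
proof -
  let ?m = "inv_into {0..1} \<phi>"
  have bij: "inj_on \<phi> {0..1}" "\<phi> ` {0..1} = {0..1}"
    using time_changes_bij[OF l] by (auto simp: bij_betw_def)
  have mem: "?m t \<in> {0..1}" and inv: "\<phi> (?m t) = t" if "t \<in> {0..1}" for t
    using that bij(2) inv_into_into[of t \<phi> "{0..1}"] f_inv_into_f[of t \<phi> "{0..1}"] by auto
  have "?m 0 = 0" "?m 1 = 1"
    using inv_into_f_f[OF bij(1), of 0] inv_into_f_f[OF bij(1), of 1] l
    by (auto simp: time_changes_def)
  moreover have "continuous_on {0..1} ?m"
    using continuous_on_inv[of "{0..1}" \<phi> ?m] bij l by (auto simp: time_changes_def)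
  moreover have "strict_mono_on {0..1} ?m"
  proof (rule strict_mono_onI)
    fix r s :: real assume rs: "r \<in> {0..1}" "s \<in> {0..1}" "r < s"
    show "?m r < ?m s"
    proof (rule ccontr)
      assume "\<not> ?m r < ?m s"
      then have "\<phi> (?m s) \<le> \<phi> (?m r)"
        using l mem[OF rs(1)] mem[OF rs(2)] unfolding time_changes_def strict_mono_on_def
        by (cases "?m s = ?m r") (auto intro!: less_imp_le)
      then show False using inv rs by simp
    qed
  qed
  ultimately show ?thesis using mem by (auto simp: time_changes_def)
qed

lemma bdd_time:
  assumes "\<phi> \<in> time_changes"
  shows "bdd_above ((\<lambda>t. \<bar>\<phi> t - t\<bar>) ` {0..1})"
proof (rule bdd_aboveI2)
  fix t :: real assume "t \<in> {0..1}"
  then have "\<phi> t \<in> {0..1}" "t \<in> {0..1}" using assms by (auto simp: time_changes_def)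
  then show "\<bar>\<phi> t - t\<bar> \<le> 1" by auto
qed

lemma bdd_space:
  assumes "\<phi> \<in> time_changes"
  shows "bdd_above ((\<lambda>t. \<bar>cadlag_fun x t - cadlag_fun y (\<phi> t)\<bar>) ` {0..1})"
proof -
  obtain A B where AB: "\<forall>t\<in>{0..1}. \<bar>cadlag_fun x t\<bar> \<le> A" "\<forall>t\<in>{0..1}. \<bar>cadlag_fun y t\<bar> \<le> B"
    using cadlag_bounded by metis
  show ?thesis
  proof (rule bdd_aboveI2)
    fix t :: real assume t: "t \<in> {0..1}"
    then have "\<phi> t \<in> {0..1}" using assms by (auto simp: time_changes_def)
    then have "\<bar>cadlag_fun x t\<bar> \<le> A" "\<bar>cadlag_fun y (\<phi> t)\<bar> \<le> B" using t AB by blast+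
    then show "\<bar>cadlag_fun x t - cadlag_fun y (\<phi> t)\<bar> \<le> A + B" by linarith
  qed
qed

lemma cost_time:
  assumes "\<phi> \<in> time_changes" "t \<in> {0..1}"
  shows "\<bar>\<phi> t - t\<bar> \<le> skorokhod_cost x y \<phi>"
  using cSUP_upper[OF assms(2) bdd_time[OF assms(1)]] by (simp add: skorokhod_cost_def)

lemma cost_space:
  assumes "\<phi> \<in> time_changes" "t \<in> {0..1}"
  shows "\<bar>cadlag_fun x t - cadlag_fun y (\<phi> t)\<bar> \<le> skorokhod_cost x y \<phi>"
  using cSUP_upper[OF assms(2) bdd_space[OF assms(1), of x y]] by (simp add: skorokhod_cost_def)

lemma cost_le:
  assumes "\<And>t. t \<in> {0..1} \<Longrightarrow> \<bar>\<phi> t - t\<bar> \<le> c"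
    and "\<And>t. t \<in> {0..1} \<Longrightarrow> \<bar>cadlag_fun x t - cadlag_fun y (\<phi> t)\<bar> \<le> c"
  shows "skorokhod_cost x y \<phi> \<le> c"
  using assms unfolding skorokhod_cost_def by (auto intro!: cSUP_least)

lemma cost_nonneg:
  assumes "\<phi> \<in> time_changes"
  shows "0 \<le> skorokhod_cost x y \<phi>"
  using cost_time[OF assms, of 0 x y] by auto

lemma cost_compose:
  assumes "\<phi> \<in> time_changes" "\<psi> \<in> time_changes"
  shows "skorokhod_cost x z (\<psi> \<circ> \<phi>) \<le> skorokhod_cost x y \<phi> + skorokhod_cost y z \<psi>"
proof (rule cost_le)
  fix t :: real assume t: "t \<in> {0..1}"
  then have lt: "\<phi> t \<in> {0..1}" using assms(1) by (auto simp: time_changes_def)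
  show "\<bar>(\<psi> \<circ> \<phi>) t - t\<bar> \<le> skorokhod_cost x y \<phi> + skorokhod_cost y z \<psi>"
    using cost_time[OF assms(1) t, of x y] cost_time[OF assms(2) lt, of y z] by simp
  show "\<bar>cadlag_fun x t - cadlag_fun z ((\<psi> \<circ> \<phi>) t)\<bar> \<le> skorokhod_cost x y \<phi> + skorokhod_cost y z \<psi>"
    using cost_space[OF assms(1) t, of x y] cost_space[OF assms(2) lt, of y z] by simp
qed

lemma cost_inverse:
  assumes l: "\<phi> \<in> time_changes"
  shows "skorokhod_cost y x (inv_into {0..1} \<phi>) \<le> skorokhod_cost x y \<phi>"
proof (rule cost_le)
  fix t :: real assume t: "t \<in> {0..1}"
  let ?s = "inv_into {0..1} \<phi> t"
  have s: "?s \<in> {0..1}" "\<phi> ?s = t"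
    using t time_changes_bij[OF l] inv_into_into[of t \<phi> "{0..1}"] f_inv_into_f[of t \<phi> "{0..1}"]
    by (auto simp: bij_betw_def)
  show "\<bar>?s - t\<bar> \<le> skorokhod_cost x y \<phi>"
    using cost_time[OF l s(1), of x y] s(2) by (simp add: abs_minus_commute)
  show "\<bar>cadlag_fun y t - cadlag_fun x ?s\<bar> \<le> skorokhod_cost x y \<phi>"
    using cost_space[OF l s(1), of x y] s(2) by (simp add: abs_minus_commute)
qed

instantiation cadlag :: metric_space
begin

definition dist_cadlag where
  "dist (x :: cadlag) y = (INF \<phi>\<in>time_changes. skorokhod_cost x y \<phi>)"

definition uniformity_cadlag where
  "(uniformity :: (cadlag \<times> cadlag) filter) = (INF e\<in>{0<..}. principal {(x, y). dist x y < e})"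

definition open_cadlag where
  "open (U :: cadlag set) \<longleftrightarrow> (\<forall>x\<in>U. \<forall>\<^sub>F (x', y) in uniformity. x' = x \<longrightarrow> y \<in> U)"

instance
proof
  have bdd: "bdd_below (skorokhod_cost x y ` time_changes)" for x y
    using cost_nonneg by (rule bdd_belowI2)
  have le: "dist x y \<le> skorokhod_cost x y \<phi>" if "\<phi> \<in> time_changes" for x y \<phi>
    unfolding dist_cadlag_def using bdd that by (rule cINF_lower)
  have near: "\<exists>\<phi>\<in>time_changes. skorokhod_cost x y \<phi> < e" if "dist x y < e" for x y e
    using that time_changes_id bdd unfolding dist_cadlag_def by (subst (asm) cINF_less_iff) auto
  have nonneg: "0 \<le> dist x y" for x y :: cadlag
    unfolding dist_cadlag_def using time_changes_id by (auto intro!: cINF_greatest cost_nonneg)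
  have sym: "dist x y \<le> dist y x" for x y :: cadlag
  proof (rule dense_ge)
    fix e assume "dist y x < e"
    then obtain \<phi> where l: "\<phi> \<in> time_changes" "skorokhod_cost y x \<phi> < e" using near by blast
    then show "dist x y \<le> e"
      using le[OF time_changes_inverse[OF l(1)], of x y] cost_inverse[OF l(1), of x y] by linarith
  qed
  fix x y z :: cadlag
  show "dist x y \<le> dist x z + dist y z"
  proof (rule field_le_epsilon)
    fix e :: real assume e: "0 < e"
    obtain \<phi> where l: "\<phi> \<in> time_changes" "skorokhod_cost x z \<phi> < dist x z + e / 2"
      using near[of x z "dist x z + e / 2"] e by auto
    obtain \<psi> where m: "\<psi> \<in> time_changes" "skorokhod_cost z y \<psi> < dist z y + e / 2"
      using near[of z y "dist z y + e / 2"] e by auto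
    show "dist x y \<le> dist x z + dist y z + e"
      using le[OF time_changes_compose[OF l(1) m(1)], of x y] cost_compose[OF l(1) m(1), of x y z]
        l(2) m(2) sym[of z y] by linarith
  qed
  show "dist x y = 0 \<longleftrightarrow> x = y"
  proof
    assume "x = y"
    moreover have "skorokhod_cost x x (\<lambda>t. t) \<le> 0" by (rule cost_le) auto
    ultimately show "dist x y = 0" using le[OF time_changes_id, of x x] nonneg[of x x] by simp
  next
    assume d0: "dist x y = 0"
    have eq: "cadlag_fun x s = cadlag_fun y s" if s: "s \<in> {0..1}" for s
    proof (rule ccontr)
      assume ne: "cadlag_fun x s \<noteq> cadlag_fun y s"
      define e where "e = \<bar>cadlag_fun x s - cadlag_fun y s\<bar> / 3"
      have e: "e > 0" using ne by (simp add: e_def)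
      show False
      proof (cases "s = 1")
        case True
        obtain \<phi> where l: "\<phi> \<in> time_changes" "skorokhod_cost x y \<phi> < e"
          using near[of x y e] e d0 by auto
        have "\<bar>cadlag_fun x 1 - cadlag_fun y 1\<bar> < e"
          using cost_space[OF l(1), of 1 x y] l by (auto simp: time_changes_def)
        then show False using True e by (simp add: e_def)
      next
        case False
        then have s': "0 \<le> s" "s < 1" using s by auto
        have "eventually (\<lambda>u. dist (cadlag_fun x u) (cadlag_fun x s) < e) (at_right s)"
          "eventually (\<lambda>u. dist (cadlag_fun y u) (cadlag_fun y s) < e) (at_right s)"
          using cadlag_right[OF s'] e by (auto dest: tendstoD)
        then have "eventually (\<lambda>u. dist (cadlag_fun x u) (cadlag_fun x s) < e \<and>
            dist (cadlag_fun y u) (cadlag_fun y s) < e) (at_right s)"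
          by (rule eventually_conj)
        then obtain b where b: "b > s" "\<And>u. s < u \<Longrightarrow> u < b \<Longrightarrow>
            \<bar>cadlag_fun x u - cadlag_fun x s\<bar> < e \<and> \<bar>cadlag_fun y u - cadlag_fun y s\<bar> < e"
          unfolding eventually_at_right_field dist_real_def by blast
        define h where "h = (min b 1 - s) / 2"
        have h: "h > 0" "s + 2 * h \<le> b" "s + 2 * h \<le> 1" using b(1) s' by (auto simp: h_def min_def field_simps)
        obtain \<phi> where l: "\<phi> \<in> time_changes" "skorokhod_cost x y \<phi> < min e h"
          using near[of x y "min e h"] e h d0 by auto
        have u: "s + h \<in> {0..1}" using h s' by auto
        have lu: "s < \<phi> (s + h)" "\<phi> (s + h) < b"
          using cost_time[OF l(1) u, of x y] l(2) h by auto
        have "\<bar>cadlag_fun x (s + h) - cadlag_fun x s\<bar> < e" using b(2)[of "s + h"] h by auto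
        moreover have "\<bar>cadlag_fun y (\<phi> (s + h)) - cadlag_fun y s\<bar> < e" using b(2)[OF lu] by auto
        moreover have "\<bar>cadlag_fun x (s + h) - cadlag_fun y (\<phi> (s + h))\<bar> < e"
          using cost_space[OF l(1) u, of x y] l(2) by auto
        ultimately have "\<bar>cadlag_fun x s - cadlag_fun y s\<bar> < 3 * e" by linarith
        then show False by (simp add: e_def)
      qed
    qed
    have "cadlag_fun x = cadlag_fun y"
      using cadlag_fun[of x] cadlag_fun[of y] eq by (intro extensionalityI[of _ "{0..1}"]) auto
    then show "x = y" by (simp add: cadlag_fun_inject)
  qed
qed (simp_all add: uniformity_cadlag_def open_cadlag_def)

end

text \<open>The set \<open>0 = t 0 < t 1 < \<dots> < t v = 1\<close> is given by its enumeration.\<close>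

definition sparse_sets :: "real \<Rightarrow> (nat \<times> (nat \<Rightarrow> real)) set" where
  "sparse_sets \<delta> =
     {(v, t). t 0 = 0 \<and> t v = 1 \<and> (\<forall>i\<in>{1..v}. t (i - 1) < t i) \<and> (\<forall>i\<in>{1..v}. t i - t (i - 1) > \<delta>)}"

text \<open>
  The modulus is meaningful for \<open>0 < \<delta> < 1\<close> only: for \<open>\<delta> \<ge> 1\<close> there are no sparse sets. Note that
  \<open>t 0 \<noteq> t v\<close> forces \<open>v \<ge> 1\<close>, so the maximum is over a nonempty set.
\<close>

definition cadlag_modulus :: "cadlag \<Rightarrow> real \<Rightarrow> real" where
  "cadlag_modulus x \<delta> =
     (INF (v, t)\<in>sparse_sets \<delta>. MAX i\<in>{1..v}.
        SUP (r, s)\<in>{t (i - 1)..<t i} \<times> {t (i - 1)..<t i}. \<bar>cadlag_fun x s - cadlag_fun x r\<bar>)"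

text \<open>Sequences are indexed by \<open>n \<ge> 1\<close>; the entry at \<open>0\<close> is ignored.\<close>

definition tight_sequence :: "(nat \<Rightarrow> cadlag measure) \<Rightarrow> bool" where
  "tight_sequence P \<longleftrightarrow> (\<forall>\<epsilon>>0. \<exists>K. compact K \<and> (\<forall>n\<ge>1. measure (P n) K > 1 - \<epsilon>))"

end

theory Submission
  imports Defs
begin

text \<open>
  Tightness asks for compact sets of large mass, so the theorem rests on the Arzela-Ascoli theorem for
  cadlag paths: a set of paths is relatively compact when its norms are bounded and its moduli
  \<open>w'(\<delta>)\<close> tend to \<open>0\<close> uniformly as \<open>\<delta>\<close> tends to \<open>0\<close>.

  For necessity, the sets \<open>sup_norm x < m\<close> and \<open>w'_x(\<delta>) < e\<close> are open
  (\<open>open_sup_norm_less\<close>, \<open>open_cadlag_modulus_less\<close>), grow as \<open>m\<close> grows and \<open>\<delta>\<close> shrinks, and exhaust the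
  space, because every single path is bounded and has \<open>w'_x(\<delta>)\<close> tending to \<open>0\<close>
  (\<open>cadlag_modulus_small_at_fine_scale\<close>). A compact set lies in one of them (\<open>tail_small_of_tight\<close>).
  Openness also shows that the events in question are Borel sets.

  For sufficiency, the bounds for large \<open>n\<close> extend to all \<open>n\<close> by continuity of each measure from above
  (\<open>tail_small_uniformly\<close>), and a geometric choice of error probabilities leaves, up to small mass, a set of
  paths with bounded norms and uniformly controlled moduli (\<open>tight_of_tail_small\<close>). Its closure
  is compact (\<open>compact_closure_bounded_modulus\<close>): for each \<open>k\<close> the paths are within \<open>\<epsilon> k\<close> of step paths
  on sparse grids, and a diagonal subsequence makes the nodes and values of all these step paths
  converge. The limit step paths are uniformly Cauchy in \<open>k\<close>, their uniform limit is cadlag, and piecewise linear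
  time changes that match the grids give convergence in the Skorokhod metric
  (\<open>grids_convergent_imp_convergent\<close>).

  The equivalence of the two forms of the modulus condition is the monotonicity of \<open>w'_x(\<delta>)\<close> in \<open>\<delta>\<close>.
\<close>

section \<open>Grids and the modulus\<close>

text \<open>
  A grid with \<open>v\<close> cells is given by its nodes \<open>t 0, \<dots>, t v\<close>. The cells are half open, so a jump of the
  path at a node contributes to no oscillation, and the right end point of the interval lies in no
  cell: the value of a path at \<open>1\<close> always has to be treated separately.
\<close>

definition grid :: "real \<Rightarrow> real \<Rightarrow> nat \<Rightarrow> (nat \<Rightarrow> real) \<Rightarrow> bool" where
  "grid a b v t \<longleftrightarrow> t 0 = a \<and> t v = b \<and> (\<forall>i<v. t i < t (Suc i))"

definition oscillation_le :: "(real \<Rightarrow> real) \<Rightarrow> real \<Rightarrow> nat \<Rightarrow> (nat \<Rightarrow> real) \<Rightarrow> bool" where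
  "oscillation_le f c v t \<longleftrightarrow>
     (\<forall>i<v. \<forall>r\<in>{t i..<t (Suc i)}. \<forall>s\<in>{t i..<t (Suc i)}. \<bar>f s - f r\<bar> \<le> c)"

lemma grid_less:
  assumes "grid a b v t" "i < j" "j \<le> v"
  shows "t i < t j"
  using assms(2,3)
proof (induction j)
  case (Suc j)
  then have "t j < t (Suc j)" using assms(1) by (auto simp: grid_def)
  then show ?case using Suc by (cases "i = j") auto
qed simp

lemma grid_le: "grid a b v t \<Longrightarrow> i \<le> j \<Longrightarrow> j \<le> v \<Longrightarrow> t i \<le> t j"
  using grid_less[of a b v t i j] by (cases "i = j") auto

lemma grid_bounds:
  assumes "grid a b v t" "i \<le> v"
  shows "a \<le> t i" "t i \<le> b"
  using grid_le[OF assms(1), of 0 i] grid_le[OF assms(1), of i v] assms by (auto simp: grid_def)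

lemma grid_cell_subset:
  assumes "grid a b v t" "i < v" "r \<in> {t i..<t (Suc i)}"
  shows "a \<le> r" "r < b"
  using assms grid_bounds[OF assms(1), of i] grid_bounds[OF assms(1), of "Suc i"] by auto

lemma grid_cell_exists:
  assumes "grid a b v t" "a \<le> r" "r < b"
  obtains i where "i < v" "r \<in> {t i..<t (Suc i)}"
proof -
  have "\<exists>i<j. r \<in> {t i..<t (Suc i)}" if "j \<le> v" "r < t j" for j
    using that
  proof (induction j)
    case 0
    then show ?case using assms by (auto simp: grid_def)
  next
    case (Suc j)
    then show ?case by (cases "r < t j") (auto simp: less_Suc_eq)
  qed
  then show thesis using assms that by (force simp: grid_def)
qed

lemma grid_pos: "grid a b v t \<Longrightarrow> a < b \<Longrightarrow> 0 < v"
  by (cases v) (auto simp: grid_def)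

lemma mem_sparse_sets_iff:
  "(v, t) \<in> sparse_sets \<delta> \<longleftrightarrow> grid 0 1 v t \<and> (\<forall>i<v. t (Suc i) - t i > \<delta>)"
proof -
  have "(\<forall>i\<in>{1..v}. Q i) \<longleftrightarrow> (\<forall>i<v. Q (Suc i))" for Q
  proof safe
    fix i assume "\<forall>i<v. Q (Suc i)" "i \<in> {1..v}"
    then show "Q i" by (cases i) auto
  qed auto
  then show ?thesis by (auto simp: sparse_sets_def grid_def)
qed

text \<open>
  Sparseness bounds the number of cells. This is what lets the number of cells be made constant
  along a subsequence.
\<close>

lemma sparse_sets_card:
  assumes "(v, t) \<in> sparse_sets \<delta>"
  shows "real v * \<delta> \<le> 1"
proof -
  have g: "grid 0 1 v t" "\<And>i. i < v \<Longrightarrow> t (Suc i) - t i > \<delta>"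
    using assms by (auto simp: mem_sparse_sets_iff)
  have "real j * \<delta> \<le> t j" if "j \<le> v" for j
    using that
  proof (induction j)
    case 0
    then show ?case using g(1) by (simp add: grid_def)
  next
    case (Suc j)
    then show ?case using g(2)[of j] by (simp add: algebra_simps)
  qed
  from this[of v] show ?thesis using g(1) by (simp add: grid_def)
qed

definition cell_oscillation :: "cadlag \<Rightarrow> (nat \<Rightarrow> real) \<Rightarrow> nat \<Rightarrow> real" where
  "cell_oscillation x t i =
     (SUP (r, s)\<in>{t (i - 1)..<t i} \<times> {t (i - 1)..<t i}. \<bar>cadlag_fun x s - cadlag_fun x r\<bar>)"

lemma cell_oscillation_upper:
  assumes "grid 0 1 v t" "i < v" "r \<in> {t i..<t (Suc i)}" "s \<in> {t i..<t (Suc i)}"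
  shows "\<bar>cadlag_fun x s - cadlag_fun x r\<bar> \<le> cell_oscillation x t (Suc i)"
proof -
  obtain B where B: "\<And>u. u \<in> {0..1} \<Longrightarrow> \<bar>cadlag_fun x u\<bar> \<le> B" using cadlag_bounded[of x] by blast
  have sub: "u \<in> {0..1}" if "u \<in> {t i..<t (Suc i)}" for u
    using grid_cell_subset[OF assms(1,2) that] by auto
  have "\<bar>cadlag_fun x s' - cadlag_fun x r'\<bar> \<le> 2 * B"
    if "r' \<in> {t i..<t (Suc i)}" "s' \<in> {t i..<t (Suc i)}" for r' s'
    using B[OF sub[OF that(1)]] B[OF sub[OF that(2)]] by linarith
  then have "bdd_above ((\<lambda>(r, s). \<bar>cadlag_fun x s - cadlag_fun x r\<bar>) `
      ({t i..<t (Suc i)} \<times> {t i..<t (Suc i)}))"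
    by (intro bdd_aboveI2[of _ _ "2 * B"]) auto
  from cSUP_upper[OF _ this, of "(r, s)"] show ?thesis
    using assms(3,4) by (auto simp: cell_oscillation_def)
qed

lemma sparse_sets_pos: "(v, t) \<in> sparse_sets \<delta> \<Longrightarrow> 0 < v"
  by (cases v) (auto simp: mem_sparse_sets_iff grid_def)

lemma cell_oscillation_nonneg:
  assumes "grid 0 1 v t" "i < v"
  shows "0 \<le> cell_oscillation x t (Suc i)"
  using cell_oscillation_upper[OF assms, of "t i" "t i" x] assms by (auto simp: grid_def)

lemma cadlag_modulus_eq:
  "cadlag_modulus x \<delta> = (INF (v, t)\<in>sparse_sets \<delta>. MAX i\<in>{1..v}. cell_oscillation x t i)"
  by (simp add: cadlag_modulus_def cell_oscillation_def)

lemma max_oscillation_nonneg: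
  assumes "(v, t) \<in> sparse_sets \<delta>"
  shows "0 \<le> (MAX i\<in>{1..v}. cell_oscillation x t i)"
proof -
  have "0 \<le> cell_oscillation x t (Suc 0)"
    using assms cell_oscillation_nonneg sparse_sets_pos by (auto simp: mem_sparse_sets_iff)
  also have "\<dots> \<le> (MAX i\<in>{1..v}. cell_oscillation x t i)"
    using sparse_sets_pos[OF assms] by (intro Max_ge) auto
  finally show ?thesis .
qed

lemma bdd_below_oscillations:
  "bdd_below ((\<lambda>(v, t). MAX i\<in>{1..v}. cell_oscillation x t i) ` sparse_sets \<delta>)"
proof (rule bdd_belowI2[of _ 0], clarify)
  fix v t assume "(v, t) \<in> sparse_sets \<delta>"
  then show "0 \<le> (MAX i\<in>{1..v}. cell_oscillation x t i)" by (rule max_oscillation_nonneg)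
qed

lemma cadlag_modulus_le:
  assumes s: "(v, t) \<in> sparse_sets \<delta>" and o: "oscillation_le (cadlag_fun x) c v t"
  shows "cadlag_modulus x \<delta> \<le> c"
proof -
  have g: "grid 0 1 v t" using s by (simp add: mem_sparse_sets_iff)
  have "cell_oscillation x t i \<le> c" if i: "i \<in> {1..v}" for i
  proof -
    obtain j where j: "i = Suc j" "j < v" using i by (cases i) auto
    then have "t j < t (Suc j)" using g by (auto simp: grid_def)
    then show ?thesis
      unfolding cell_oscillation_def j(1) using o j(2)
      by (intro cSUP_least) (auto simp: oscillation_le_def)
  qed
  then have "(MAX i\<in>{1..v}. cell_oscillation x t i) \<le> c"
    using sparse_sets_pos[OF s] by (subst Max_le_iff) auto
  moreover have "cadlag_modulus x \<delta> \<le> (MAX i\<in>{1..v}. cell_oscillation x t i)"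
    unfolding cadlag_modulus_eq using cINF_lower[OF bdd_below_oscillations s] by simp
  ultimately show ?thesis by simp
qed

lemma sparse_sets_nonempty: "\<delta> < 1 \<Longrightarrow> sparse_sets \<delta> \<noteq> {}"
  using mem_sparse_sets_iff[of 1 real \<delta>] by (auto simp: grid_def)

text \<open>
  Together with \<open>cadlag_modulus_le\<close> this trades the infimum of maxima of suprema for a single grid and a
  pointwise bound. The strict gap between \<open>c\<close> and \<open>e\<close> is the room in which paths are
  moved in the proof of upper semicontinuity.
\<close>

lemma cadlag_modulus_lessE:
  assumes "\<delta> < 1" "cadlag_modulus x \<delta> < e"
  obtains v t c where "(v, t) \<in> sparse_sets \<delta>" "c < e" "oscillation_le (cadlag_fun x) c v t"
proof -
  obtain v t where s: "(v, t) \<in> sparse_sets \<delta>" "(MAX i\<in>{1..v}. cell_oscillation x t i) < e"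
    using assms(2) cINF_less_iff[OF sparse_sets_nonempty[OF assms(1)] bdd_below_oscillations, of x e]
    unfolding cadlag_modulus_eq by auto
  have "oscillation_le (cadlag_fun x) (MAX i\<in>{1..v}. cell_oscillation x t i) v t"
    unfolding oscillation_le_def
  proof (intro allI impI ballI)
    fix i r s' assume i: "i < v" and rs: "r \<in> {t i..<t (Suc i)}" "s' \<in> {t i..<t (Suc i)}"
    have "\<bar>cadlag_fun x s' - cadlag_fun x r\<bar> \<le> cell_oscillation x t (Suc i)"
      using s(1) i rs by (intro cell_oscillation_upper) (auto simp: mem_sparse_sets_iff)
    also have "\<dots> \<le> (MAX i\<in>{1..v}. cell_oscillation x t i)"
      using i by (intro Max_ge) auto
    finally show "\<bar>cadlag_fun x s' - cadlag_fun x r\<bar> \<le> (MAX i\<in>{1..v}. cell_oscillation x t i)" .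
  qed
  with s show thesis using that by blast
qed

lemma sparse_sets_antimono: "\<delta> \<le> \<delta>' \<Longrightarrow> sparse_sets \<delta>' \<subseteq> sparse_sets \<delta>"
  by (force simp: mem_sparse_sets_iff)

lemma cadlag_modulus_mono:
  assumes "\<delta> \<le> \<delta>'" "\<delta>' < 1"
  shows "cadlag_modulus x \<delta> \<le> cadlag_modulus x \<delta>'"
  unfolding cadlag_modulus_eq
  using assms sparse_sets_nonempty sparse_sets_antimono bdd_below_oscillations
  by (intro cINF_superset_mono) auto

section \<open>Borel measurability of the norm and modulus events\<close>

lemma dist_cadlag_le: "\<phi> \<in> time_changes \<Longrightarrow> dist x y \<le> skorokhod_cost x y \<phi>"
  unfolding dist_cadlag_def
  by (intro cINF_lower bdd_belowI2[of _ 0]) (auto intro: cost_nonneg)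

lemma dist_cadlag_lessE:
  assumes "dist x y < e"
  obtains \<phi> where "\<phi> \<in> time_changes" "skorokhod_cost x y \<phi> < e"
proof -
  have "bdd_below (skorokhod_cost x y ` time_changes)"
    by (intro bdd_belowI2[of _ 0]) (auto intro: cost_nonneg)
  then show thesis
    using assms that time_changes_id unfolding dist_cadlag_def
    by (subst (asm) cINF_less_iff) auto
qed

lemma abs_le_sup_norm: "t \<in> {0..1} \<Longrightarrow> \<bar>cadlag_fun x t\<bar> \<le> sup_norm x"
proof -
  assume t: "t \<in> {0..1}"
  have "bdd_above ((\<lambda>t. \<bar>cadlag_fun x t\<bar>) ` {0..1})"
    using cadlag_bounded[of x] by (auto simp: bdd_above_def)
  then show ?thesis unfolding sup_norm_def by (rule cSUP_upper[OF t])
qed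

lemma sup_norm_le_dist: "sup_norm x \<le> sup_norm y + dist x y"
proof (rule field_le_epsilon)
  fix e :: real assume "0 < e"
  then obtain \<phi> where p: "\<phi> \<in> time_changes" "skorokhod_cost x y \<phi> < dist x y + e"
    using dist_cadlag_lessE[of x y "dist x y + e"] by auto
  show "sup_norm x \<le> sup_norm y + dist x y + e"
    unfolding sup_norm_def[of x]
  proof (rule cSUP_least)
    fix t :: real assume t: "t \<in> {0..1}"
    then have "\<phi> t \<in> {0..1}" using p by (auto simp: time_changes_def)
    then show "\<bar>cadlag_fun x t\<bar> \<le> sup_norm y + dist x y + e"
      using abs_le_sup_norm[of "\<phi> t" y] cost_space[OF p(1) t, of x y] p(2) by linarith
  qed simp
qed

lemma open_sup_norm_less: "open {x. sup_norm x < a}"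
proof (rule openI)
  fix x assume "x \<in> {x. sup_norm x < a}"
  moreover have "sup_norm y < a" if "dist x y < a - sup_norm x" for y
    using that sup_norm_le_dist[of y x] by (simp add: dist_commute)
  ultimately show "\<exists>e>0. ball x e \<subseteq> {x. sup_norm x < a}"
    by (intro exI[of _ "a - sup_norm x"]) auto
qed

text \<open>
  The modulus is upper semicontinuous in the path. If \<open>\<phi>\<close> nearly realises the distance of \<open>x\<close> and \<open>y\<close>,
  the image under \<open>\<phi>\<close> of a good grid for \<open>x\<close> is a good grid for \<open>y\<close>; its gaps still exceed \<open>\<delta>\<close>
  because finitely many strict inequalities \<open>t (Suc i) - t i > \<delta>\<close> survive a small perturbation. Openness
  makes the events in the theorem Borel sets and gives the compactness argument for tight sequences.
\<close>

lemma open_cadlag_modulus_less: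
  assumes d: "\<delta> < 1"
  shows "open {x. cadlag_modulus x \<delta> < e}"
proof (rule openI)
  fix x assume "x \<in> {x. cadlag_modulus x \<delta> < e}"
  then obtain v t c where s: "(v, t) \<in> sparse_sets \<delta>" "c < e" "oscillation_le (cadlag_fun x) c v t"
    using cadlag_modulus_lessE[OF d, of x e] by auto
  have g: "grid 0 1 v t" "\<And>i. i < v \<Longrightarrow> t (Suc i) - t i > \<delta>"
    using s(1) by (auto simp: mem_sparse_sets_iff)
  have v: "{..<v} \<noteq> {}" using sparse_sets_pos[OF s(1)] by auto
  \<comment> \<open>\<open>m\<close> is the slack in the sparseness condition, \<open>e - c\<close> the slack in the oscillation; both a gap
    and an oscillation change by less than \<open>2 * \<rho>\<close>.\<close>
  define m where "m = (MIN i\<in>{..<v}. t (Suc i) - t i) - \<delta>"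
  have m: "m > 0" "\<And>i. i < v \<Longrightarrow> \<delta> + m \<le> t (Suc i) - t i"
    using v g(2) by (auto simp: m_def Min_gr_iff)
  define \<rho> where "\<rho> = min m (e - c) / 4"
  have \<rho>: "\<rho> > 0" "4 * \<rho> \<le> m" "4 * \<rho> \<le> e - c" using m s(2) by (auto simp: \<rho>_def)
  have "cadlag_modulus y \<delta> < e" if close: "dist x y < \<rho>" for y
  proof -
    obtain \<phi> where p: "\<phi> \<in> time_changes" "skorokhod_cost x y \<phi> < \<rho>"
      using dist_cadlag_lessE[OF close] by blast
    have ti: "t i \<in> {0..1}" if "i \<le> v" for i using grid_bounds[OF g(1) that] by auto
    have near: "\<bar>\<phi> r - r\<bar> < \<rho>" "\<bar>cadlag_fun x r - cadlag_fun y (\<phi> r)\<bar> < \<rho>" if "r \<in> {0..1}" for r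
      using cost_time[OF p(1) that, of x y] cost_space[OF p(1) that, of x y] p(2) by auto
    have gap: "\<delta> < \<phi> (t (Suc i)) - \<phi> (t i)" if "i < v" for i
      using near(1)[OF ti[of i]] near(1)[OF ti[of "Suc i"]] m(2)[OF that] \<rho> that by auto
    have mono: "strict_mono_on {0..1} \<phi>" using p by (auto simp: time_changes_def)
    have "\<phi> (t i) < \<phi> (t (Suc i))" if "i < v" for i
      using strict_mono_onD[OF mono ti ti, of i "Suc i"] g(1) that by (auto simp: grid_def)
    then have "(v, \<phi> \<circ> t) \<in> sparse_sets \<delta>"
      using g(1) gap p(1) by (auto simp: mem_sparse_sets_iff grid_def time_changes_def)
    moreover have "oscillation_le (cadlag_fun y) (c + 2 * \<rho>) v (\<phi> \<circ> t)"
      unfolding oscillation_le_def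
    proof (intro allI impI ballI)
      fix i r s'
      assume i: "i < v" and rs: "r \<in> {(\<phi> \<circ> t) i..<(\<phi> \<circ> t) (Suc i)}" "s' \<in> {(\<phi> \<circ> t) i..<(\<phi> \<circ> t) (Suc i)}"
      \<comment> \<open>Each point of a cell of the image grid comes from the same cell of the old grid.\<close>
      have pre: "\<exists>q\<in>{t i..<t (Suc i)}. q \<in> {0..1} \<and> \<phi> q = u"
        if u: "u \<in> {(\<phi> \<circ> t) i..<(\<phi> \<circ> t) (Suc i)}" for u
      proof -
        have "\<exists>q\<ge>t i. q \<le> t (Suc i) \<and> \<phi> q = u"
        proof (rule IVT')
          show "continuous_on {t i..t (Suc i)} \<phi>"
            using p(1) ti[of i] ti[of "Suc i"] i
            by (auto simp: time_changes_def intro: continuous_on_subset)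
          show "t i \<le> t (Suc i)" using g(1) i by (auto simp: grid_def intro: less_imp_le)
        qed (use u in auto)
        then obtain q where q: "t i \<le> q" "q \<le> t (Suc i)" "\<phi> q = u" by blast
        then have "q \<noteq> t (Suc i)" using u by auto
        then show ?thesis using q ti[of i] ti[of "Suc i"] i by (intro bexI[of _ q]) auto
      qed
      obtain q q' where q: "q \<in> {t i..<t (Suc i)}" "q \<in> {0..1}" "\<phi> q = r"
        and q': "q' \<in> {t i..<t (Suc i)}" "q' \<in> {0..1}" "\<phi> q' = s'"
        using pre[OF rs(1)] pre[OF rs(2)] by blast
      have "\<bar>cadlag_fun x q' - cadlag_fun x q\<bar> \<le> c"
        using s(3) i q(1) q'(1) unfolding oscillation_le_def by blast
      then show "\<bar>cadlag_fun y s' - cadlag_fun y r\<bar> \<le> c + 2 * \<rho>"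
        using near(2)[OF q(2)] near(2)[OF q'(2)] q(3) q'(3) by auto
    qed
    ultimately have "cadlag_modulus y \<delta> \<le> c + 2 * \<rho>" by (rule cadlag_modulus_le)
    then show ?thesis using \<rho> by linarith
  qed
  then show "\<exists>\<rho>>0. ball x \<rho> \<subseteq> {x. cadlag_modulus x \<delta> < e}"
    using \<rho>(1) by (intro exI[of _ \<rho>]) auto
qed

section \<open>Cadlag paths are the paths with arbitrarily fine grids\<close>

definition has_fine_grid :: "(real \<Rightarrow> real) \<Rightarrow> real \<Rightarrow> real \<Rightarrow> real \<Rightarrow> bool" where
  "has_fine_grid f e a b \<longleftrightarrow> (\<exists>v t. grid a b v t \<and> oscillation_le f e v t)"

lemma has_fine_grid_trans:
  assumes "has_fine_grid f e a b" "has_fine_grid f e b c"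
  shows "has_fine_grid f e a c"
proof -
  obtain v t v' t' where g: "grid a b v t" "oscillation_le f e v t"
    and g': "grid b c v' t'" "oscillation_le f e v' t'"
    using assms by (auto simp: has_fine_grid_def)
  define u where "u i = (if i \<le> v then t i else t' (i - v))" for i
  have cell: "(u i = t i \<and> u (Suc i) = t (Suc i) \<and> i < v) \<or>
      (u i = t' (i - v) \<and> u (Suc i) = t' (Suc (i - v)) \<and> i - v < v')" if "i < v + v'" for i
    using that g(1) g'(1) by (cases i v rule: linorder_cases) (auto simp: u_def grid_def Suc_diff_le)
  have "u i < u (Suc i)" if "i < v + v'" for i
    using cell[OF that] g(1) g'(1) by (auto simp: grid_def)
  then have "grid a c (v + v') u"
    using g(1) g'(1) by (auto simp: grid_def u_def)
  moreover have "oscillation_le f e (v + v') u"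
    unfolding oscillation_le_def
  proof (intro allI impI)
    fix i assume "i < v + v'"
    from cell[OF this] show "\<forall>r\<in>{u i..<u (Suc i)}. \<forall>s\<in>{u i..<u (Suc i)}. \<bar>f s - f r\<bar> \<le> e"
      using g(2) g'(2) by (elim disjE) (auto simp: oscillation_le_def)
  qed
  ultimately show ?thesis by (auto simp: has_fine_grid_def)
qed

lemma has_fine_grid_single:
  assumes "a \<le> b" "\<And>r. r \<in> {a..<b} \<Longrightarrow> \<bar>f r - l\<bar> \<le> e / 2"
  shows "has_fine_grid f e a b"
proof (cases "a = b")
  case True
  then have "grid a b 0 (\<lambda>_. a) \<and> oscillation_le f e 0 (\<lambda>_. a)"
    by (simp add: grid_def oscillation_le_def)
  then show ?thesis unfolding has_fine_grid_def by blast
next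
  case False
  define t where "t i = (if i = 0 then a else b)" for i :: nat
  have "\<bar>f s - f r\<bar> \<le> e" if "r \<in> {a..<b}" "s \<in> {a..<b}" for r s
    using assms(2)[OF that(1)] assms(2)[OF that(2)] by linarith
  then have "grid a b 1 t \<and> oscillation_le f e 1 t"
    using False assms(1) by (simp add: grid_def oscillation_le_def t_def)
  then show ?thesis unfolding has_fine_grid_def by blast
qed

text \<open>
  Near a point \<open>t\<close> the path stays close to its left limit before \<open>t\<close> and close to its value from \<open>t\<close>
  on, so short intervals around \<open>t\<close> have a fine grid with at most one interior node, namely \<open>t\<close>. Fine
  grids of adjacent intervals concatenate, and bisection carries the local property to \<open>[0,1]\<close>.
\<close>

lemma cadlag_has_fine_grid:
  assumes e: "e > 0"
  shows "has_fine_grid (cadlag_fun x) e 0 1"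
proof -
  let ?P = "\<lambda>a b. 0 \<le> a \<longrightarrow> b \<le> 1 \<longrightarrow> has_fine_grid (cadlag_fun x) e a b"
  have "?P 0 1"
  proof (rule Bolzano[of 0 1 ?P])
    fix a b c :: real assume "?P a b" "?P b c" "a \<le> b" "b \<le> c"
    then show "?P a c" using has_fine_grid_trans by auto
  next
    fix t :: real assume t: "0 \<le> t" "t \<le> 1"
    have "\<exists>d>0. \<exists>l. \<forall>r. t - d < r \<and> r < t \<and> 0 \<le> r \<longrightarrow> \<bar>cadlag_fun x r - l\<bar> \<le> e / 2"
    proof (cases "t = 0")
      case False
      then obtain l where "(cadlag_fun x \<longlongrightarrow> l) (at_left t)" using t cadlag_left[of t x] by auto
      then have "eventually (\<lambda>r. dist (cadlag_fun x r) l < e / 2) (at_left t)"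
        using e by (intro tendstoD) auto
      then obtain b where "b < t" "\<forall>r. b < r \<longrightarrow> r < t \<longrightarrow> dist (cadlag_fun x r) l < e / 2"
        unfolding eventually_at_left_field by auto
      then show ?thesis by (intro exI[of _ "t - b"]) (auto simp: dist_real_def intro!: exI[of _ l] less_imp_le)
    qed (auto intro: exI[of _ 1])
    then obtain d l where dl: "d > 0"
      "\<And>r. t - d < r \<Longrightarrow> r < t \<Longrightarrow> 0 \<le> r \<Longrightarrow> \<bar>cadlag_fun x r - l\<bar> \<le> e / 2" by blast
    have "\<exists>d>0. \<forall>r. t \<le> r \<and> r < t + d \<and> r < 1 \<longrightarrow> \<bar>cadlag_fun x r - cadlag_fun x t\<bar> \<le> e / 2"
    proof (cases "t = 1")
      case False
      then have "(cadlag_fun x \<longlongrightarrow> cadlag_fun x t) (at_right t)" using t cadlag_right[of t x] by auto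
      then have "eventually (\<lambda>r. dist (cadlag_fun x r) (cadlag_fun x t) < e / 2) (at_right t)"
        using e by (intro tendstoD) auto
      then obtain b where b: "b > t" "\<And>r. t < r \<Longrightarrow> r < b \<Longrightarrow> \<bar>cadlag_fun x r - cadlag_fun x t\<bar> < e / 2"
        unfolding eventually_at_right_field dist_real_def by auto
      show ?thesis
      proof (intro exI[of _ "b - t"] conjI allI impI)
        fix r assume "t \<le> r \<and> r < t + (b - t) \<and> r < 1"
        then show "\<bar>cadlag_fun x r - cadlag_fun x t\<bar> \<le> e / 2"
          using b(2)[of r] e by (cases "r = t") auto
      qed (use b in auto)
    qed (auto intro: exI[of _ 1])
    then obtain d' where d': "d' > 0"
      "\<And>r. t \<le> r \<Longrightarrow> r < t + d' \<Longrightarrow> r < 1 \<Longrightarrow> \<bar>cadlag_fun x r - cadlag_fun x t\<bar> \<le> e / 2" by blast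
    show "\<exists>d>0. \<forall>a b. a \<le> t \<and> t \<le> b \<and> b - a < d \<longrightarrow> ?P a b"
    proof (intro exI[of _ "min d d'"] conjI allI impI)
      fix a b assume ab: "a \<le> t \<and> t \<le> b \<and> b - a < min d d'" and *: "0 \<le> a" "b \<le> 1"
      have "has_fine_grid (cadlag_fun x) e a t"
        using ab * by (intro has_fine_grid_single[of _ _ _ l] dl) auto
      moreover have "has_fine_grid (cadlag_fun x) e t b"
        using ab * by (intro has_fine_grid_single[of _ _ _ "cadlag_fun x t"] d') auto
      ultimately show "has_fine_grid (cadlag_fun x) e a b" by (rule has_fine_grid_trans)
    qed (use dl d' in auto)
  qed simp
  then show ?thesis by simp
qed

lemma cadlag_modulus_small_at_fine_scale:
  assumes "e > 0"
  shows "\<exists>\<delta>\<in>{0<..<1}. cadlag_modulus x \<delta> < e"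
proof -
  obtain v t where g: "grid 0 1 v t" "oscillation_le (cadlag_fun x) (e / 2) v t"
    using cadlag_has_fine_grid[of "e / 2" x] assms by (auto simp: has_fine_grid_def)
  define m where "m = (MIN i\<in>{..<v}. t (Suc i) - t i)"
  have v: "{..<v} \<noteq> {}" using grid_pos[OF g(1)] by auto
  have m: "m > 0" "\<And>i. i < v \<Longrightarrow> m \<le> t (Suc i) - t i"
    using v g(1) by (auto simp: m_def Min_gr_iff grid_def)
  define \<delta> where "\<delta> = min m 1 / 2"
  have \<delta>: "0 < \<delta>" "\<delta> < 1" "\<delta> < m" using m(1) by (auto simp: \<delta>_def)
  have "\<delta> < t (Suc i) - t i" if "i < v" for i using m(2)[OF that] \<delta>(3) by linarith
  then have "(v, t) \<in> sparse_sets \<delta>" using g(1) by (auto simp: mem_sparse_sets_iff)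
  from cadlag_modulus_le[OF this g(2)] show ?thesis using \<delta> assms by force
qed

text \<open>
  The converse, used to recognise limits of step paths as cadlag. A point \<open>r < 1\<close> shares its cell
  with a right neighbourhood, a point \<open>r > 0\<close> is approached from the left within one cell; the latter
  gives the Cauchy property of the path along \<open>at_left r\<close>.
\<close>

lemma cadlag_on_unitI_fine_grid:
  assumes fine: "\<And>e. e > 0 \<Longrightarrow> has_fine_grid x e 0 1"
  shows "cadlag_on_unit x"
  unfolding cadlag_on_unit_def
proof (intro conjI ballI)
  fix r :: real assume r: "r \<in> {0..<1}"
  show "(x \<longlongrightarrow> x r) (at_right r)"
  proof (rule tendstoI)
    fix e :: real assume e: "e > 0"
    then obtain v t where g: "grid 0 1 v t" "oscillation_le x (e / 2) v t"
      using fine[of "e / 2"] by (auto simp: has_fine_grid_def)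
    obtain i where i: "i < v" "r \<in> {t i..<t (Suc i)}" using grid_cell_exists[OF g(1)] r by auto
    have "\<bar>x s - x r\<bar> \<le> e / 2" if "r < s" "s < t (Suc i)" for s
      using g(2) i that by (auto simp: oscillation_le_def)
    then have "dist (x s) (x r) < e" if "r < s" "s < t (Suc i)" for s
      using that e by (fastforce simp: dist_real_def)
    then show "eventually (\<lambda>s. dist (x s) (x r) < e) (at_right r)"
      using i(2) unfolding eventually_at_right_field by (intro exI[of _ "t (Suc i)"]) auto
  qed
next
  fix r :: real assume r: "r \<in> {0<..1}"
  have cauchy: "\<exists>b<r. \<forall>s q. b < s \<and> s < r \<and> b < q \<and> q < r \<longrightarrow> \<bar>x s - x q\<bar> \<le> e"
    if e: "e > 0" for e
  proof -
    obtain v t where g: "grid 0 1 v t" "oscillation_le x e v t"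
      using fine[OF e] by (auto simp: has_fine_grid_def)
    \<comment> \<open>The least node at or after \<open>r\<close> ends the cell that contains a left neighbourhood of \<open>r\<close>, even
      if \<open>r\<close> itself is that node.\<close>
    define i where "i = (LEAST i. i \<le> v \<and> r \<le> t i)"
    have ex: "v \<le> v \<and> r \<le> t v" using g(1) r by (auto simp: grid_def)
    have i: "i \<le> v" "r \<le> t i" using LeastI[of "\<lambda>i. i \<le> v \<and> r \<le> t i", OF ex] by (auto simp: i_def)
    have "i \<noteq> 0" using i(2) r g(1) by (intro notI) (simp add: grid_def)
    then obtain j where j: "i = Suc j" by (cases i) auto
    have "t j < r" using not_less_Least[of j "\<lambda>i. i \<le> v \<and> r \<le> t i"] i(1) j by (auto simp: i_def)
    moreover have "\<bar>x s - x q\<bar> \<le> e" if "t j < s \<and> s < r \<and> t j < q \<and> q < r" for s q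
    proof -
      have "s \<in> {t j..<t (Suc j)}" "q \<in> {t j..<t (Suc j)}" using that i(2) j by auto
      moreover have "j < v" using i(1) j by simp
      ultimately show ?thesis using g(2) by (simp add: oscillation_le_def)
    qed
    ultimately show ?thesis by blast
  qed
  have "cauchy_filter (filtermap x (at_left r))"
    unfolding cauchy_filter_metric_filtermap
  proof (intro allI impI)
    fix e :: real assume e: "e > 0"
    then obtain b where b: "b < r" "\<And>s q. b < s \<and> s < r \<and> b < q \<and> q < r \<Longrightarrow> \<bar>x s - x q\<bar> \<le> e / 2"
      using cauchy[of "e / 2"] by auto
    have "eventually (\<lambda>s. b < s \<and> s < r) (at_left r)"
      using b(1) unfolding eventually_at_left_field by blast
    moreover have "dist (x s) (x q) < e" if "b < s \<and> s < r" "b < q \<and> q < r" for s q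
      using b(2)[of s q] that e by (auto simp: dist_real_def)
    ultimately show "\<exists>P. eventually P (at_left r) \<and> (\<forall>x' y. P x' \<and> P y \<longrightarrow> dist (x x') (x y) < e)"
      by blast
  qed
  moreover have "filtermap x (at_left r) \<noteq> bot" by (simp add: filtermap_bot_iff)
  moreover have "filtermap x (at_left r) \<le> principal UNIV" by simp
  ultimately obtain l where "filtermap x (at_left r) \<le> nhds l"
    using complete_UNIV[where 'a = real, unfolded complete_uniform, rule_format] by metis
  then show "\<exists>l. (x \<longlongrightarrow> l) (at_left r)" unfolding filterlim_def by blast
qed

section \<open>Skorokhod distance from matching grids\<close>

text \<open>
  The time change is the piecewise linear interpolation with \<open>\<phi> (t i) = u i\<close>, written as a sum of
  clamped ramps: \<open>w i\<close> climbs from \<open>0\<close> to \<open>1\<close> exactly across the \<open>i\<close>-th cell, so continuity and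
  monotonicity hold term by term. On a cell the displacement \<open>\<phi> r - r\<close> is a convex combination of the
  displacements at its two nodes, hence bounded by \<open>c\<close>.
\<close>

lemma time_change_between_grids:
  assumes t: "grid 0 1 v t" and u: "grid 0 1 v u"
    and near: "\<And>i. i \<le> v \<Longrightarrow> \<bar>t i - u i\<bar> \<le> c"
  obtains \<phi> where "\<phi> \<in> time_changes"
    "\<And>i r. i < v \<Longrightarrow> r \<in> {t i..<t (Suc i)} \<Longrightarrow> \<phi> r \<in> {u i..<u (Suc i)}"
    "\<And>r. r \<in> {0..1} \<Longrightarrow> \<bar>\<phi> r - r\<bar> \<le> c"
proof -
  define w where "w i r = max 0 (min 1 ((r - t i) / (t (Suc i) - t i)))" for i r
  define \<phi> where "\<phi> r = (\<Sum>i<v. (u (Suc i) - u i) * w i r)" for r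
  have tp: "t i < t (Suc i)" and up: "u i < u (Suc i)" if "i < v" for i
    using t u that by (auto simp: grid_def)
  have on_cell: "\<phi> r = u i + (u (Suc i) - u i) * ((r - t i) / (t (Suc i) - t i))"
    if i: "i < v" and r: "t i \<le> r" "r \<le> t (Suc i)" for i r
  proof -
    have left: "w j r = 1" if "j < i" for j
      using grid_le[OF t, of "Suc j" i] tp[of j] that i r by (simp add: w_def field_simps)
    have right: "w j r = 0" if "i < j" "j < v" for j
    proof -
      have "r \<le> t j" using grid_le[OF t, of "Suc i" j] that r by simp
      then have "(r - t j) / (t (Suc j) - t j) \<le> 0" using tp[OF that(2)] by (intro divide_nonpos_pos) auto
      then have "min 1 ((r - t j) / (t (Suc j) - t j)) \<le> 0" by (rule min.coboundedI2)
      then show ?thesis unfolding w_def by (rule max_absorb1)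
    qed
    have mid: "w i r = (r - t i) / (t (Suc i) - t i)"
      using tp[OF i] r by (simp add: w_def)
    have "\<phi> r = (\<Sum>j\<in>{..<Suc i}. (u (Suc j) - u j) * w j r)"
      unfolding \<phi>_def by (rule sum.mono_neutral_right) (use i right in auto)
    also have "\<dots> = (\<Sum>j<i. u (Suc j) - u j) + (u (Suc i) - u i) * w i r"
      using left by simp
    also have "(\<Sum>j<i. u (Suc j) - u j) = u i"
      using u by (simp add: sum_lessThan_telescope grid_def)
    finally show ?thesis by (simp add: mid)
  qed
  have cell: "\<exists>i<v. t i \<le> r \<and> r \<le> t (Suc i)" if "r \<in> {0..1}" for r
  proof (cases "r = 1")
    case True
    obtain k where "v = Suc k" using grid_pos[OF t] by (cases v) auto
    then show ?thesis using True t grid_bounds(2)[OF t, of k] by (intro exI[of _ k]) (auto simp: grid_def)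
  next
    case False
    then have "0 \<le> r" "r < 1" using that by auto
    then obtain i where "i < v" "r \<in> {t i..<t (Suc i)}" by (rule grid_cell_exists[OF t])
    then show ?thesis by (intro exI[of _ i]) auto
  qed
  have into: "\<phi> r \<in> {u i..<u (Suc i)}" if i: "i < v" and r: "r \<in> {t i..<t (Suc i)}" for i r
  proof -
    have "0 \<le> (r - t i) / (t (Suc i) - t i)" "(r - t i) / (t (Suc i) - t i) < 1"
      using tp[OF i] r by auto
    then have "0 \<le> (u (Suc i) - u i) * ((r - t i) / (t (Suc i) - t i))"
      "(u (Suc i) - u i) * ((r - t i) / (t (Suc i) - t i)) < u (Suc i) - u i"
      using up[OF i] by (auto intro!: mult_nonneg_nonneg simp: mult_less_cancel_left2 simp del: times_divide_eq_right)
    then show ?thesis using on_cell[OF i, of r] r by auto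
  qed
  have at_node: "\<phi> (t i) = u i" if "i \<le> v" for i
  proof (cases "i < v")
    case True
    then show ?thesis using on_cell[of i "t i"] tp[of i] by auto
  next
    case False
    then have "i = v" using that by simp
    moreover obtain k where "v = Suc k" using grid_pos[OF t] by (cases v) auto
    ultimately have k: "v = Suc k" "i = v" by auto
    then show ?thesis using on_cell[of k "t v"] tp[of k] by auto
  qed
  have close: "\<bar>\<phi> r - r\<bar> \<le> c" if "r \<in> {0..1}" for r
  proof -
    obtain i where i: "i < v" "t i \<le> r" "r \<le> t (Suc i)" using cell \<open>r \<in> {0..1}\<close> by blast
    define l where "l = (r - t i) / (t (Suc i) - t i)"
    have l: "0 \<le> l" "l \<le> 1" "r = t i + l * (t (Suc i) - t i)"
      using tp[OF i(1)] i by (auto simp: l_def)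
    have "\<phi> r - r = (1 - l) * (u i - t i) + l * (u (Suc i) - t (Suc i))"
      unfolding on_cell[OF i] l_def[symmetric] by (subst l(3)) (simp add: algebra_simps)
    also have "\<bar>\<dots>\<bar> \<le> (1 - l) * \<bar>u i - t i\<bar> + l * \<bar>u (Suc i) - t (Suc i)\<bar>"
      using l by (intro order_trans[OF abs_triangle_ineq]) (simp add: abs_mult)
    also have "\<dots> \<le> (1 - l) * c + l * c"
      using l near[of i] near[of "Suc i"] i(1)
      by (intro add_mono mult_left_mono) (auto simp: abs_minus_commute)
    finally show ?thesis by (simp add: algebra_simps)
  qed
  have mono: "mono_on {0..1} \<phi>"
  proof (rule mono_onI)
    fix r s :: real assume "r \<le> s"
    then have "w i r \<le> w i s" if "i < v" for i
      using tp[OF that] unfolding w_def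
      by (intro max.mono min.mono divide_right_mono) auto
    then show "\<phi> r \<le> \<phi> s"
      unfolding \<phi>_def using up by (intro sum_mono mult_left_mono) (auto intro: less_imp_le)
  qed
  have strict: "\<phi> r < \<phi> s" if rs: "r \<in> {0..1}" "s \<in> {0..1}" "r < s" for r s
  proof -
    obtain i where i: "i < v" "r \<in> {t i..<t (Suc i)}"
      using grid_cell_exists[OF t, of r] rs by auto
    define q where "q = min s (t (Suc i))"
    have q: "t i \<le> q" "q \<le> t (Suc i)" "r < q" "q \<le> s" "q \<in> {0..1}"
      using i(2) rs by (auto simp: q_def)
    have "\<phi> r < \<phi> q"
      using on_cell[OF i(1), of r] on_cell[OF i(1) q(1,2)] i(2) q tp[OF i(1)] up[OF i(1)]
      by (simp add: divide_strict_right_mono mult_strict_left_mono del: times_divide_eq_right)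
    also have "\<dots> \<le> \<phi> s" using mono_onD[OF mono q(5) rs(2) q(4)] .
    finally show ?thesis .
  qed
  have ends: "\<phi> 0 = 0" "\<phi> 1 = 1"
    using at_node[of 0] at_node[of v] t u by (auto simp: grid_def)
  have "continuous_on {0..1} \<phi>"
    unfolding \<phi>_def w_def by (intro continuous_intros) (use tp in force)
  moreover have "\<phi> r \<in> {0..1}" if "r \<in> {0..1}" for r
    using mono_onD[OF mono, of 0 r] mono_onD[OF mono, of r 1] that ends by auto
  ultimately have "\<phi> \<in> time_changes"
    using ends strict by (auto simp: time_changes_def intro: strict_mono_onI)
  from that[OF this into close] show thesis .
qed

lemma dist_cadlag_le_of_grids:
  assumes t: "grid 0 1 v t" and u: "grid 0 1 v u"
    and near: "\<And>i. i \<le> v \<Longrightarrow> \<bar>t i - u i\<bar> \<le> c"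
    and val: "\<And>i r s. i < v \<Longrightarrow> r \<in> {t i..<t (Suc i)} \<Longrightarrow> s \<in> {u i..<u (Suc i)} \<Longrightarrow>
      \<bar>cadlag_fun x r - cadlag_fun y s\<bar> \<le> c"
    and val1: "\<bar>cadlag_fun x 1 - cadlag_fun y 1\<bar> \<le> c"
  shows "dist x y \<le> c"
proof -
  obtain \<phi> where p: "\<phi> \<in> time_changes"
    "\<And>i r. i < v \<Longrightarrow> r \<in> {t i..<t (Suc i)} \<Longrightarrow> \<phi> r \<in> {u i..<u (Suc i)}"
    "\<And>r. r \<in> {0..1} \<Longrightarrow> \<bar>\<phi> r - r\<bar> \<le> c"
    using time_change_between_grids[OF t u near] by blast
  have "skorokhod_cost x y \<phi> \<le> c"
  proof (rule cost_le[OF p(3)])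
    fix r :: real assume r: "r \<in> {0..1}"
    show "\<bar>cadlag_fun x r - cadlag_fun y (\<phi> r)\<bar> \<le> c"
    proof (cases "r = 1")
      case True
      then show ?thesis using val1 p(1) by (simp add: time_changes_def)
    next
      case False
      then obtain i where "i < v" "r \<in> {t i..<t (Suc i)}"
        using grid_cell_exists[OF t, of r] r by auto
      then show ?thesis using val p(2) by blast
    qed
  qed
  then show ?thesis using dist_cadlag_le[OF p(1), of x y] by simp
qed

section \<open>Relative compactness\<close>

text \<open>
  Step functions \<open>s k\<close> with value \<open>a k i\<close> on the \<open>i\<close>-th cell of the \<open>k\<close>-th grid are uniformly Cauchy if
  any two of their cells that meet carry values at distance at most \<open>\<epsilon> k + \<epsilon> l\<close>. The uniform
  limit oscillates by at most \<open>2 * \<epsilon> k\<close> on the cells of the \<open>k\<close>-th grid and is therefore cadlag.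
\<close>

lemma cadlag_of_compatible_steps:
  fixes a :: "nat \<Rightarrow> nat \<Rightarrow> real"
  assumes grid: "\<And>k. grid 0 1 (v k) (t k)"
    and compat: "\<And>k l i j r. i < v k \<Longrightarrow> j < v l \<Longrightarrow> r \<in> {t k i..<t k (Suc i)} \<Longrightarrow>
      r \<in> {t l j..<t l (Suc j)} \<Longrightarrow> \<bar>a k i - a l j\<bar> \<le> \<epsilon> k + \<epsilon> l"
    and eps: "\<epsilon> \<longlonglongrightarrow> 0"
  shows "\<exists>x. cadlag_fun x 1 = z \<and>
    (\<forall>k. \<forall>i<v k. \<forall>r\<in>{t k i..<t k (Suc i)}. \<bar>cadlag_fun x r - a k i\<bar> \<le> \<epsilon> k)"
proof -
  have "\<exists>i. i < v k \<and> r \<in> {t k i..<t k (Suc i)}" if "r \<in> {0..<1}" for k r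
    using grid_cell_exists[OF grid, of r k] that by auto
  note ex = someI_ex[OF this]
  define j where "j k r = (SOME i. i < v k \<and> r \<in> {t k i..<t k (Suc i)})" for k r
  have j: "j k r < v k" "r \<in> {t k (j k r)..<t k (Suc (j k r))}" if "r \<in> {0..<1}" for k r
    using ex[OF that, of k] by (simp_all add: j_def)
  have "\<exists>l. (\<lambda>k. a k (j k r)) \<longlonglongrightarrow> l" if r: "r \<in> {0..<1}" for r
  proof -
    have "Cauchy (\<lambda>k. a k (j k r))"
    proof (rule metric_CauchyI)
      fix e :: real assume e: "e > 0"
      then obtain N where N: "\<And>k. k \<ge> N \<Longrightarrow> \<bar>\<epsilon> k\<bar> < e / 2"
        using LIMSEQ_D[OF eps, of "e / 2"] by auto
      have "dist (a k (j k r)) (a l (j l r)) < e" if "k \<ge> N" "l \<ge> N" for k l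
        using compat[OF j(1)[OF r] j(1)[OF r] j(2)[OF r] j(2)[OF r], of k l] N[OF that(1)] N[OF that(2)]
        by (auto simp: dist_real_def)
      then show "\<exists>M. \<forall>m\<ge>M. \<forall>n\<ge>M. dist (a m (j m r)) (a n (j n r)) < e" by blast
    qed
    then show ?thesis by (simp add: Cauchy_convergent_iff convergent_def)
  qed
  then obtain y where y: "\<And>r. r \<in> {0..<1} \<Longrightarrow> (\<lambda>k. a k (j k r)) \<longlonglongrightarrow> y r" by metis
  \<comment> \<open>No cell contains \<open>1\<close>, so the value there is free; it is prescribed by \<open>z\<close>.\<close>
  define x where "x = restrict (y(1 := z)) {0..1}"
  have x: "\<bar>x r - a k i\<bar> \<le> \<epsilon> k" if i: "i < v k" and r: "r \<in> {t k i..<t k (Suc i)}" for k i r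
  proof -
    have r01: "r \<in> {0..<1}" using grid_cell_subset[OF grid i r] by auto
    have "(\<lambda>l. \<bar>a l (j l r) - a k i\<bar>) \<longlonglongrightarrow> \<bar>y r - a k i\<bar>"
      by (intro tendsto_intros y r01)
    moreover have "(\<lambda>l. \<epsilon> k + \<epsilon> l) \<longlonglongrightarrow> \<epsilon> k + 0" by (intro tendsto_intros eps)
    moreover have "\<bar>a l (j l r) - a k i\<bar> \<le> \<epsilon> k + \<epsilon> l" for l
      using compat[OF i j(1)[OF r01] r j(2)[OF r01], of l] by (simp add: abs_minus_commute)
    ultimately have "\<bar>y r - a k i\<bar> \<le> \<epsilon> k + 0" by (intro LIMSEQ_le) auto
    then show ?thesis using r01 by (simp add: x_def)
  qed
  have "cadlag_on_unit x"
  proof (rule cadlag_on_unitI_fine_grid)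
    fix e :: real assume e: "e > 0"
    then obtain k where k: "\<bar>\<epsilon> k\<bar> < e / 2" using LIMSEQ_D[OF eps, of "e / 2"] by auto
    have "oscillation_le x e (v k) (t k)"
      unfolding oscillation_le_def
    proof (intro allI impI ballI)
      fix i r s assume "i < v k" "r \<in> {t k i..<t k (Suc i)}" "s \<in> {t k i..<t k (Suc i)}"
      then show "\<bar>x s - x r\<bar> \<le> e" using x[of i k r] x[of i k s] k by linarith
    qed
    then show "has_fine_grid x e 0 1" using grid by (auto simp: has_fine_grid_def)
  qed
  then have *: "cadlag_fun (Abs_cadlag x) = x" by (intro Abs_cadlag_inverse) (auto simp: x_def)
  have "x 1 = z" by (simp add: x_def)
  then show ?thesis
    by (intro exI[of _ "Abs_cadlag x"] conjI allI impI ballI; unfold *) (assumption | rule x)+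
qed

text \<open>
  Suppose that for every \<open>k\<close> the nodes \<open>T n k i\<close> and the values of \<open>Y n\<close> at them converge to \<open>t k i\<close> and
  \<open>a k i\<close>. If a cell of the limit grid \<open>k\<close> meets a cell of the limit grid \<open>l\<close>, then, being half open,
  they share a point \<open>q\<close> interior to both. For large \<open>n\<close> it lies in the corresponding cells of the grids
  of \<open>Y n\<close>, where \<open>Y n q\<close> is within \<open>\<epsilon> k\<close> and within \<open>\<epsilon> l\<close> of the two nodal values.
  So the limit values are compatible and define a cadlag path \<open>x\<close>; matching the grids of
  \<open>Y n\<close> with the limit grids shows convergence to \<open>x\<close>. The limit
  is constructed explicitly because Cauchy sequences for this metric need not converge.
\<close>

lemma grids_convergent_imp_convergent:
  fixes Y :: "nat \<Rightarrow> cadlag"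
  assumes osc: "\<And>k. eventually (\<lambda>n. grid 0 1 (v k) (T n k) \<and>
      oscillation_le (cadlag_fun (Y n)) (\<epsilon> k) (v k) (T n k)) sequentially"
    and grid: "\<And>k. grid 0 1 (v k) (t k)"
    and nodes: "\<And>k i. i \<le> v k \<Longrightarrow> (\<lambda>n. T n k i) \<longlonglongrightarrow> t k i"
    and vals: "\<And>k i. i \<le> v k \<Longrightarrow> (\<lambda>n. cadlag_fun (Y n) (T n k i)) \<longlonglongrightarrow> a k i"
    and eps: "\<epsilon> \<longlonglongrightarrow> 0"
  shows "\<exists>x. Y \<longlonglongrightarrow> x"
proof -
  have end_node: "t k (v k) = 1" for k using grid[of k] by (simp add: grid_def)
  have "eventually (\<lambda>n. cadlag_fun (Y n) (T n k (v k)) = cadlag_fun (Y n) 1) sequentially" for k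
    using osc[of k] by eventually_elim (simp add: grid_def)
  from tendsto_cong[OF this] have lim1: "(\<lambda>n. cadlag_fun (Y n) 1) \<longlonglongrightarrow> a k (v k)" for k
    using vals[of "v k" k] by simp
  define z where "z = a 0 (v 0)"
  have az: "a k (v k) = z" for k unfolding z_def by (rule LIMSEQ_unique[OF lim1 lim1])
  \<comment> \<open>Strict inequalities are essential: the nodes of \<open>Y n\<close> may approach theirs from either side.\<close>
  have near_cell: "eventually (\<lambda>n. \<bar>cadlag_fun (Y n) r - cadlag_fun (Y n) (T n k i)\<bar> \<le> \<epsilon> k) sequentially"
    if i: "i < v k" and r: "t k i < r" "r < t k (Suc i)" for k i r
  proof -
    have "eventually (\<lambda>n. T n k i < r) sequentially" "eventually (\<lambda>n. r < T n k (Suc i)) sequentially"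
      using nodes[of i k] nodes[of "Suc i" k] i r by (auto dest: order_tendstoD)
    then show ?thesis using osc[of k]
      by eventually_elim (use i in \<open>auto simp: oscillation_le_def\<close>)
  qed
  have compat: "\<bar>a k i - a l j\<bar> \<le> \<epsilon> k + \<epsilon> l"
    if i: "i < v k" and j: "j < v l" and r: "r \<in> {t k i..<t k (Suc i)}" "r \<in> {t l j..<t l (Suc j)}"
    for k l i j r
  proof -
    define q where "q = (r + min (t k (Suc i)) (t l (Suc j))) / 2"
    have q: "t k i < q" "q < t k (Suc i)" "t l j < q" "q < t l (Suc j)"
      using r by (auto simp: q_def min_def field_simps)
    have "(\<lambda>n. \<bar>cadlag_fun (Y n) (T n k i) - cadlag_fun (Y n) (T n l j)\<bar>) \<longlonglongrightarrow> \<bar>a k i - a l j\<bar>"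
      using i j by (intro tendsto_intros vals) auto
    moreover have "eventually (\<lambda>n. \<bar>cadlag_fun (Y n) (T n k i) - cadlag_fun (Y n) (T n l j)\<bar> \<le> \<epsilon> k + \<epsilon> l) sequentially"
      using near_cell[OF i q(1,2)] near_cell[OF j q(3,4)] by eventually_elim linarith
    ultimately show ?thesis by (rule tendsto_upperbound) simp
  qed
  have "\<exists>x. cadlag_fun x 1 = z \<and>
    (\<forall>k. \<forall>i<v k. \<forall>r\<in>{t k i..<t k (Suc i)}. \<bar>cadlag_fun x r - a k i\<bar> \<le> \<epsilon> k)"
    by (rule cadlag_of_compatible_steps[OF grid _ eps]) (rule compat)
  then obtain x where x1: "cadlag_fun x 1 = z" and
    x_all: "\<forall>k. \<forall>i<v k. \<forall>r\<in>{t k i..<t k (Suc i)}. \<bar>cadlag_fun x r - a k i\<bar> \<le> \<epsilon> k"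
    by (elim exE conjE)
  have x: "\<bar>cadlag_fun x r - a k i\<bar> \<le> \<epsilon> k" if "i < v k" "r \<in> {t k i..<t k (Suc i)}" for k i r
    using x_all[rule_format, OF that] .
  have "Y \<longlonglongrightarrow> x"
  proof (rule tendstoI)
    fix e :: real assume e: "e > 0"
    then obtain k where k: "\<bar>\<epsilon> k\<bar> < e / 4" using LIMSEQ_D[OF eps, of "e / 4"] by auto
    have "eventually (\<lambda>n. \<forall>i\<in>{..v k}. dist (T n k i) (t k i) < e / 4 \<and>
        dist (cadlag_fun (Y n) (T n k i)) (a k i) < e / 4) sequentially"
      using e by (intro eventually_ball_finite ballI eventually_conj tendstoD[OF nodes] tendstoD[OF vals]) auto
    with osc[of k] show "eventually (\<lambda>n. dist (Y n) x < e) sequentially"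
    proof eventually_elim
      case (elim n)
      then have g: "grid 0 1 (v k) (T n k)" and o: "oscillation_le (cadlag_fun (Y n)) (\<epsilon> k) (v k) (T n k)"
        and c1: "\<And>i. i \<le> v k \<Longrightarrow> \<bar>T n k i - t k i\<bar> < e / 4"
        and c2: "\<And>i. i \<le> v k \<Longrightarrow> \<bar>cadlag_fun (Y n) (T n k i) - a k i\<bar> < e / 4"
        by (auto simp: dist_real_def)
      have "dist (Y n) x \<le> 3 * e / 4"
      proof (rule dist_cadlag_le_of_grids[OF g grid])
        show "\<bar>T n k i - t k i\<bar> \<le> 3 * e / 4" if "i \<le> v k" for i using c1[OF that] e by linarith
        have "T n k (v k) = 1" using g by (simp add: grid_def)
        then show "\<bar>cadlag_fun (Y n) 1 - cadlag_fun x 1\<bar> \<le> 3 * e / 4"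
          using c2[of "v k"] az[of k] x1 e by simp
        fix i r s assume i: "i < v k" and r: "r \<in> {T n k i..<T n k (Suc i)}" and s: "s \<in> {t k i..<t k (Suc i)}"
        have "T n k i \<in> {T n k i..<T n k (Suc i)}" using g i by (auto simp: grid_def)
        then have "\<bar>cadlag_fun (Y n) r - cadlag_fun (Y n) (T n k i)\<bar> \<le> \<epsilon> k"
          using o i r unfolding oscillation_le_def by blast
        then show "\<bar>cadlag_fun (Y n) r - cadlag_fun x s\<bar> \<le> 3 * e / 4"
          using c2[of i] x[OF i s] i k by linarith
      qed
      then show ?case using e by linarith
    qed
  qed
  then show ?thesis by blast
qed

lemma coordinatewise_convergent_subsequence:
  fixes f :: "nat \<Rightarrow> 'i::countable \<Rightarrow> 'b::metric_space"
  assumes C: "\<And>i. compact (C i)" and f: "\<And>n i. f n i \<in> C i"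
  obtains g \<sigma> where "strict_mono (\<sigma> :: nat \<Rightarrow> nat)" "\<And>i. g i \<in> C i" "\<And>i. (\<lambda>n. f (\<sigma> n) i) \<longlonglongrightarrow> g i"
proof -
  have "compactin (product_topology (\<lambda>i. euclidean) UNIV) (PiE UNIV C)"
    using C by (subst compactin_PiE) auto
  then have "compact (PiE UNIV C)" by (simp add: euclidean_product_topology)
  then have "seq_compact (PiE UNIV C)" by (simp add: compact_eq_seq_compact_metric)
  moreover have "\<forall>n. f n \<in> PiE UNIV C" using f by auto
  ultimately obtain g \<sigma> where s: "g \<in> PiE UNIV C" "strict_mono (\<sigma> :: nat \<Rightarrow> nat)" "(f \<circ> \<sigma>) \<longlonglongrightarrow> g"
    by (rule seq_compactE)
  have "(\<lambda>n. f (\<sigma> n) i) \<longlonglongrightarrow> g i" for i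
    using continuous_on_tendsto_compose[OF continuous_on_product_coordinates s(3), of i] by simp
  moreover have "g i \<in> C i" for i using s(1) by auto
  ultimately show thesis using that s(2) by blast
qed

text \<open>
  For each path and each \<open>k\<close> choose a \<open>\<delta> k\<close>-sparse grid with oscillation at most \<open>\<epsilon> k\<close>. The numbers of
  cells, the nodes and the values at the nodes are bounded for fixed \<open>k\<close>, so one subsequence makes
  all of them converge. The gaps of the limit nodes are at least \<open>\<delta> k > 0\<close>: sparseness keeps nodes
  from merging, which is why the modulus is defined with sparse sets.
\<close>

lemma bounded_modulus_convergent_subsequence:
  fixes X :: "nat \<Rightarrow> cadlag"
  assumes \<delta>: "\<And>k. 0 < \<delta> k" "\<And>k. \<delta> k < 1" and eps: "\<epsilon> \<longlonglongrightarrow> 0"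
    and bound: "\<And>n. sup_norm (X n) \<le> M"
    and modulus: "\<And>n k. cadlag_modulus (X n) (\<delta> k) < \<epsilon> k"
  obtains x \<sigma> where "strict_mono (\<sigma> :: nat \<Rightarrow> nat)" "(X \<circ> \<sigma>) \<longlonglongrightarrow> x"
proof -
  have "\<exists>p. p \<in> sparse_sets (\<delta> k) \<and> oscillation_le (cadlag_fun (X n)) (\<epsilon> k) (fst p) (snd p)" for n k
  proof -
    obtain v t c where "(v, t) \<in> sparse_sets (\<delta> k)" "c < \<epsilon> k" "oscillation_le (cadlag_fun (X n)) c v t"
      using cadlag_modulus_lessE[OF \<delta>(2) modulus] by blast
    moreover from this have "oscillation_le (cadlag_fun (X n)) (\<epsilon> k) v t"
      unfolding oscillation_le_def by fastforce
    ultimately show ?thesis by (intro exI[of _ "(v, t)"]) simp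
  qed
  note ex = someI_ex[OF this]
  define p where "p n k = (SOME p. p \<in> sparse_sets (\<delta> k) \<and>
    oscillation_le (cadlag_fun (X n)) (\<epsilon> k) (fst p) (snd p))" for n k
  have p: "p n k \<in> sparse_sets (\<delta> k)"
    "oscillation_le (cadlag_fun (X n)) (\<epsilon> k) (fst (p n k)) (snd (p n k))" for n k
    using ex[where k1 = k and n1 = n] by (simp_all only: p_def)
  define V where "V n k = fst (p n k)" for n k
  define T where "T n k = snd (p n k)" for n k
  have VT: "\<And>n k. (V n k, T n k) \<in> sparse_sets (\<delta> k)"
    "\<And>n k. oscillation_le (cadlag_fun (X n)) (\<epsilon> k) (V n k) (T n k)" for n k
    using p by (simp_all add: V_def T_def)
  have G: "grid 0 1 (V n k) (T n k)" and gap: "i < V n k \<Longrightarrow> \<delta> k < T n k (Suc i) - T n k i" for n k i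
    using VT(1)[of n k] by (auto simp: mem_sparse_sets_iff)
  \<comment> \<open>All data of the \<open>n\<close>-th path as one function on a countable index set. Capping the index by the
    number of cells keeps the values in a compact set that depends on the index only.\<close>
  define f where "f n p = (case p of (k, i) \<Rightarrow>
    (real (V n k), T n k (min i (V n k)), cadlag_fun (X n) (T n k (min i (V n k)))))" for n p
  define C where "C p = (case p of (k, i :: nat) \<Rightarrow> real ` {..nat \<lceil>1 / \<delta> k\<rceil>} \<times> {0..1::real} \<times> {-M..M})" for p
  have f_in: "f n p \<in> C p" for n p
  proof -
    obtain k i where p: "p = (k, i)" by (cases p)
    have "real (V n k) \<le> 1 / \<delta> k" using sparse_sets_card[OF VT(1)] \<delta>(1)[of k] by (simp add: field_simps)
    then have "V n k \<le> nat \<lceil>1 / \<delta> k\<rceil>" by linarith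
    moreover have t: "T n k (min i (V n k)) \<in> {0..1}" using grid_bounds[OF G, of "min i (V n k)" n k] by auto
    moreover have "\<bar>cadlag_fun (X n) (T n k (min i (V n k)))\<bar> \<le> M"
      using abs_le_sup_norm[OF t, of "X n"] bound[of n] by linarith
    ultimately show ?thesis by (auto simp: f_def C_def p abs_le_iff)
  qed
  have C_compact: "compact (C p)" for p
    by (auto simp: C_def split: prod.split intro!: compact_Times compact_Icc finite_imp_compact[OF finite_imageI[OF finite_atMost]])
  obtain g \<sigma> where \<sigma>: "strict_mono (\<sigma> :: nat \<Rightarrow> nat)" "\<And>p. g p \<in> C p"
    "\<And>p. (\<lambda>n. f (\<sigma> n) p) \<longlonglongrightarrow> g p"
    by (rule coordinatewise_convergent_subsequence[of C f, OF C_compact f_in]) (rule that)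
  \<comment> \<open>The limit of the numbers of cells lies in a finite set of integers, so they are eventually
    constant.\<close>
  define v where "v k = nat \<lfloor>fst (g (k, 0))\<rfloor>" for k
  define t where "t k i = fst (snd (g (k, i)))" for k i
  define a where "a k i = snd (snd (g (k, i)))" for k i
  have V_ev: "eventually (\<lambda>n. V (\<sigma> n) k = v k) sequentially" for k
  proof -
    have "fst (g (k, 0)) = real (v k)" using \<sigma>(2)[of "(k, 0)"] by (auto simp: C_def v_def)
    then have "(\<lambda>n. real (V (\<sigma> n) k)) \<longlonglongrightarrow> real (v k)"
      using tendsto_fst[OF \<sigma>(3)[of "(k, 0)"]] by (simp add: f_def)
    from tendstoD[OF this zero_less_one] show ?thesis
      by eventually_elim (simp add: dist_real_def abs_less_iff)
  qed
  have T_min: "(\<lambda>n. T (\<sigma> n) k (min i (V (\<sigma> n) k))) \<longlonglongrightarrow> t k i"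
    and A_min: "(\<lambda>n. cadlag_fun (X (\<sigma> n)) (T (\<sigma> n) k (min i (V (\<sigma> n) k)))) \<longlonglongrightarrow> a k i" for k i
    using tendsto_fst[OF tendsto_snd[OF \<sigma>(3)[of "(k, i)"]]] tendsto_snd[OF tendsto_snd[OF \<sigma>(3)[of "(k, i)"]]]
    by (simp_all add: f_def t_def a_def)
  have min_ev: "eventually (\<lambda>n. min i (V (\<sigma> n) k) = i) sequentially" if "i \<le> v k" for i k
    using V_ev[of k] by eventually_elim (use that in auto)
  have nodes: "(\<lambda>n. T (\<sigma> n) k i) \<longlonglongrightarrow> t k i" if "i \<le> v k" for k i
    using min_ev[OF that] by (intro Lim_transform_eventually[OF T_min]) (auto elim: eventually_mono)
  have vals: "(\<lambda>n. cadlag_fun (X (\<sigma> n)) (T (\<sigma> n) k i)) \<longlonglongrightarrow> a k i" if "i \<le> v k" for k i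
    using min_ev[OF that] by (intro Lim_transform_eventually[OF A_min]) (auto elim: eventually_mono)
  have g01: "grid 0 1 (v k) (t k)" for k
    unfolding grid_def
  proof (intro conjI allI impI)
    have "(\<lambda>n. T (\<sigma> n) k 0) \<longlonglongrightarrow> 0" using G by (simp add: grid_def)
    then show "t k 0 = 0" using nodes[of 0 k] LIMSEQ_unique by blast
    have "eventually (\<lambda>n. T (\<sigma> n) k (v k) = 1) sequentially"
      using V_ev[of k]
    proof eventually_elim
      case (elim n)
      then show ?case using G[of "\<sigma> n" k] by (simp add: grid_def)
    qed
    then have "(\<lambda>n. T (\<sigma> n) k (v k)) \<longlonglongrightarrow> 1" by (rule tendsto_eventually)
    then show "t k (v k) = 1" using nodes[of "v k" k] LIMSEQ_unique by blast
    fix i assume i: "i < v k"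
    have "eventually (\<lambda>n. \<delta> k \<le> T (\<sigma> n) k (Suc i) - T (\<sigma> n) k i) sequentially"
      using V_ev[of k]
    proof eventually_elim
      case (elim n)
      then show ?case using gap[of i "\<sigma> n" k] i by simp
    qed
    then have "\<delta> k \<le> t k (Suc i) - t k i"
      using i by (intro tendsto_lowerbound[OF tendsto_diff[OF nodes nodes]]) auto
    then show "t k i < t k (Suc i)" using \<delta>(1)[of k] by linarith
  qed
  have "\<exists>x. (X \<circ> \<sigma>) \<longlonglongrightarrow> x"
  proof (rule grids_convergent_imp_convergent[where T = "\<lambda>n. T (\<sigma> n)" and v = v and t = t and a = a])
    show "eventually (\<lambda>n. grid 0 1 (v k) (T (\<sigma> n) k) \<and>
      oscillation_le (cadlag_fun ((X \<circ> \<sigma>) n)) (\<epsilon> k) (v k) (T (\<sigma> n) k)) sequentially" for k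
      using V_ev[of k]
    proof eventually_elim
      case (elim n)
      then show ?case using G[of "\<sigma> n" k] VT(2)[of "\<sigma> n" k] by simp
    qed
  qed (use g01 nodes vals eps in \<open>auto simp: comp_def\<close>)
  then show thesis using that \<sigma>(1) by blast
qed

text \<open>
  A sequence in the closure is shadowed by a sequence in \<open>A\<close> with distances tending to \<open>0\<close>, so both
  converge along the same subsequences.
\<close>

lemma compact_closureI_sequential:
  fixes A :: "'a::metric_space set"
  assumes sub: "\<And>X. (\<And>n. X n \<in> A) \<Longrightarrow> \<exists>x \<sigma>. strict_mono (\<sigma> :: nat \<Rightarrow> nat) \<and> (X \<circ> \<sigma>) \<longlonglongrightarrow> x"
  shows "compact (closure A)"
  unfolding compact_eq_seq_compact_metric
proof (rule seq_compactI)
  fix Y :: "nat \<Rightarrow> 'a" assume Y: "\<forall>n. Y n \<in> closure A"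
  have "\<exists>x\<in>A. dist x (Y n) < inverse (real (Suc n))" for n
    using Y closure_approachable[of "Y n" A] by simp
  then obtain X where X: "\<And>n. X n \<in> A" "\<And>n. dist (X n) (Y n) < inverse (real (Suc n))" by metis
  obtain x \<sigma> where x: "strict_mono (\<sigma> :: nat \<Rightarrow> nat)" "(X \<circ> \<sigma>) \<longlonglongrightarrow> x" using sub[of X, OF X(1)] by blast
  have "(\<lambda>n. dist (X n) (Y n)) \<longlonglongrightarrow> 0"
    using X(2) by (intro tendsto_sandwich[OF _ _ tendsto_const LIMSEQ_inverse_real_of_nat])
      (auto intro!: always_eventually less_imp_le)
  from LIMSEQ_subseq_LIMSEQ[OF this x(1)]
  have d1: "(\<lambda>n. dist (X (\<sigma> n)) (Y (\<sigma> n))) \<longlonglongrightarrow> 0" by (simp add: comp_def)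
  have d2: "(\<lambda>n. dist (X (\<sigma> n)) x) \<longlonglongrightarrow> 0"
    using x(2) tendsto_dist_iff[of "X \<circ> \<sigma>" x sequentially] by (simp add: comp_def)
  have "(\<lambda>n. dist (Y (\<sigma> n)) x) \<longlonglongrightarrow> 0"
  proof (rule tendsto_sandwich[OF _ _ tendsto_const])
    show "\<forall>\<^sub>F n in sequentially. 0 \<le> dist (Y (\<sigma> n)) x" by simp
    show "\<forall>\<^sub>F n in sequentially. dist (Y (\<sigma> n)) x \<le> dist (X (\<sigma> n)) (Y (\<sigma> n)) + dist (X (\<sigma> n)) x"
      by (intro always_eventually allI dist_triangle3)
    show "(\<lambda>n. dist (X (\<sigma> n)) (Y (\<sigma> n)) + dist (X (\<sigma> n)) x) \<longlonglongrightarrow> 0"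
      using tendsto_add[OF d1 d2] by simp
  qed
  then have "(Y \<circ> \<sigma>) \<longlonglongrightarrow> x"
    using tendsto_dist_iff[of "Y \<circ> \<sigma>" x sequentially] by (simp add: comp_def)
  moreover have "x \<in> closure A"
    using x(2) X(1) unfolding closure_sequential by (intro exI[of _ "X \<circ> \<sigma>"]) simp
  ultimately show "\<exists>l\<in>closure A. \<exists>r. strict_mono (r :: nat \<Rightarrow> nat) \<and> (Y \<circ> r) \<longlonglongrightarrow> l" using x(1) by blast
qed

text \<open>
  The sufficient half of the Arzela-Ascoli characterisation of relatively compact sets of cadlag
  paths, with the modulus controlled along a sequence of scales.
\<close>

lemma compact_closure_bounded_modulus:
  assumes \<delta>: "\<And>k. 0 < \<delta> k" "\<And>k. \<delta> k < 1" and eps: "\<epsilon> \<longlonglongrightarrow> 0"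
  shows "compact (closure {x. sup_norm x < M \<and> (\<forall>k::nat. cadlag_modulus x (\<delta> k) < \<epsilon> k)})"
proof (rule compact_closureI_sequential)
  fix X :: "nat \<Rightarrow> cadlag"
  assume X: "\<And>n. X n \<in> {x. sup_norm x < M \<and> (\<forall>k::nat. cadlag_modulus x (\<delta> k) < \<epsilon> k)}"
  have "sup_norm (X n) \<le> M" "cadlag_modulus (X n) (\<delta> k) < \<epsilon> k" for n k using X[of n] by auto
  from bounded_modulus_convergent_subsequence[OF \<delta> eps this]
  obtain x \<sigma> where "strict_mono (\<sigma> :: nat \<Rightarrow> nat)" "(X \<circ> \<sigma>) \<longlonglongrightarrow> x" .
  then show "\<exists>x \<sigma>. strict_mono (\<sigma> :: nat \<Rightarrow> nat) \<and> (X \<circ> \<sigma>) \<longlonglongrightarrow> x" by blast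
qed

section \<open>Tightness\<close>

lemma limsup_tendsto_zero_iff:
  fixes g :: "'a \<Rightarrow> nat \<Rightarrow> real"
  assumes nonneg: "\<And>a n. 0 \<le> g a n"
  shows "((\<lambda>a. limsup (\<lambda>n. ereal (g a n))) \<longlongrightarrow> 0) F \<longleftrightarrow>
    (\<forall>\<eta>>0. \<forall>\<^sub>F a in F. \<forall>\<^sub>F n in sequentially. g a n \<le> \<eta>)"
proof safe
  fix \<eta> :: real assume lim: "((\<lambda>a. limsup (\<lambda>n. ereal (g a n))) \<longlongrightarrow> 0) F" and "\<eta> > 0"
  then have "\<forall>\<^sub>F a in F. limsup (\<lambda>n. ereal (g a n)) < ereal \<eta>" by (intro order_tendstoD(2)) auto
  then show "\<forall>\<^sub>F a in F. \<forall>\<^sub>F n in sequentially. g a n \<le> \<eta>"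
  proof eventually_elim
    case (elim a)
    from Limsup_lessD[OF this] show ?case by eventually_elim simp
  qed
next
  assume small: "\<forall>\<eta>>0. \<forall>\<^sub>F a in F. \<forall>\<^sub>F n in sequentially. g a n \<le> \<eta>"
  show "((\<lambda>a. limsup (\<lambda>n. ereal (g a n))) \<longlongrightarrow> 0) F"
  proof (rule order_tendstoI)
    fix c :: ereal assume "c < 0"
    moreover have "0 \<le> limsup (\<lambda>n. ereal (g a n))" for a
      using nonneg by (intro le_Limsup) auto
    ultimately show "\<forall>\<^sub>F a in F. c < limsup (\<lambda>n. ereal (g a n))"
      by (auto intro: always_eventually less_le_trans)
  next
    fix c :: ereal assume "0 < c"
    then obtain \<eta> where \<eta>: "0 < ereal \<eta>" "ereal \<eta> < c" using ereal_dense2 by blast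
    then have "\<forall>\<^sub>F a in F. \<forall>\<^sub>F n in sequentially. g a n \<le> \<eta>" using small by auto
    then show "\<forall>\<^sub>F a in F. limsup (\<lambda>n. ereal (g a n)) < c"
    proof eventually_elim
      case (elim a)
      then have "limsup (\<lambda>n. ereal (g a n)) \<le> ereal \<eta>"
        by (intro Limsup_bounded) (auto elim: eventually_mono)
      then show ?case using \<eta>(2) by simp
    qed
  qed
qed

locale borel_prob_sequence =
  fixes P :: "nat \<Rightarrow> 'a::topological_space measure"
  assumes prob: "\<And>n. n \<ge> 1 \<Longrightarrow> prob_space (P n)"
    and sets_P: "\<And>n. n \<ge> 1 \<Longrightarrow> sets (P n) = sets borel"
begin

lemma space_P: "n \<ge> 1 \<Longrightarrow> space (P n) = UNIV"
  using sets_eq_imp_space_eq[OF sets_P] by simp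

lemma measure_P_mono:
  assumes "n \<ge> 1" "A \<subseteq> B" "B \<in> sets borel"
  shows "measure (P n) A \<le> measure (P n) B"
proof -
  interpret prob_space "P n" by (rule prob[OF assms(1)])
  show ?thesis using assms sets_P by (intro finite_measure_mono) auto
qed

lemma measure_P_compl: "n \<ge> 1 \<Longrightarrow> A \<in> sets borel \<Longrightarrow> measure (P n) (- A) = 1 - measure (P n) A"
  using prob_space.prob_compl[OF prob, of n A] sets_P[of n] space_P[of n] by (simp add: Compl_eq_Diff_UNIV)

text \<open>
  Because the events shrink as the parameter moves along the filter, an iterated limit over a
  continuous parameter can be tested at a sequence of parameters.
\<close>

lemma limsup_tendsto_zero_iff_along:
  fixes q :: "nat \<Rightarrow> 'b"
  assumes q: "filterlim q F sequentially"
    and mono: "\<And>m. \<forall>\<^sub>F r in F. S r \<subseteq> S (q m)"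
    and S: "\<And>m. S (q m) \<in> sets borel"
  shows "((\<lambda>r. limsup (\<lambda>n. ereal (measure (P n) (S r)))) \<longlongrightarrow> 0) F \<longleftrightarrow>
    (\<forall>\<eta>>0. \<exists>m n\<^sub>0. \<forall>n>n\<^sub>0. measure (P n) (S (q m)) \<le> \<eta>)"
  unfolding limsup_tendsto_zero_iff[where g = "\<lambda>r n. measure (P n) (S r)", OF measure_nonneg]
proof (intro iffI allI impI)
  fix \<eta> :: real
  assume "\<forall>\<eta>>0. \<forall>\<^sub>F r in F. \<forall>\<^sub>F n in sequentially. measure (P n) (S r) \<le> \<eta>" "\<eta> > 0"
  then have "\<forall>\<^sub>F m in sequentially. \<forall>\<^sub>F n in sequentially. measure (P n) (S (q m)) \<le> \<eta>"
    using eventually_compose_filterlim[OF _ q] by blast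
  then obtain m where "\<forall>\<^sub>F n in sequentially. measure (P n) (S (q m)) \<le> \<eta>"
    using eventually_happens'[OF sequentially_bot] by blast
  then show "\<exists>m n\<^sub>0. \<forall>n>n\<^sub>0. measure (P n) (S (q m)) \<le> \<eta>"
    unfolding eventually_at_top_dense by blast
next
  fix \<eta> :: real
  assume "\<forall>\<eta>>0. \<exists>m n\<^sub>0. \<forall>n>n\<^sub>0. measure (P n) (S (q m)) \<le> \<eta>" "\<eta> > 0"
  then obtain m n\<^sub>0 where n0: "\<And>n. n > n\<^sub>0 \<Longrightarrow> measure (P n) (S (q m)) \<le> \<eta>" by blast
  from mono[of m] show "\<forall>\<^sub>F r in F. \<forall>\<^sub>F n in sequentially. measure (P n) (S r) \<le> \<eta>"
  proof eventually_elim
    case (elim r)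
    have "measure (P n) (S r) \<le> \<eta>" if "n > n\<^sub>0" for n
      using order_trans[OF measure_P_mono[OF _ elim S] n0[OF that]] that by simp
    then show ?case unfolding eventually_at_top_dense by blast
  qed
qed

lemma single_tail_small:
  assumes n: "n \<ge> 1" and U: "\<And>m. U m \<in> sets borel" "incseq U" "(\<Union>m. U m) = UNIV" and \<eta>: "\<eta> > 0"
  shows "\<exists>m. measure (P n) (- U m) \<le> \<eta>"
proof -
  interpret prob_space "P n" by (rule prob[OF n])
  have "(\<lambda>m. measure (P n) (- U m)) \<longlonglongrightarrow> measure (P n) (\<Inter>m. - U m)"
    using U(1) sets_P[OF n] incseq_SucD[OF U(2)]
    by (intro finite_Lim_measure_decseq) (auto simp: decseq_Suc_iff)
  moreover have "(\<Inter>m. - U m) = {}" using U(3) by blast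
  ultimately have "(\<lambda>m. measure (P n) (- U m)) \<longlonglongrightarrow> 0" by simp
  then have "\<forall>\<^sub>F m in sequentially. measure (P n) (- U m) < \<eta>" using \<eta> by (rule order_tendstoD)
  then show ?thesis using eventually_happens'[OF sequentially_bot] less_imp_le by blast
qed

text \<open>
  Each single measure has small tails by continuity from above, so a bound that holds for large \<open>n\<close>
  extends to all \<open>n \<ge> 1\<close> by taking the largest of finitely many indices.
\<close>

lemma tail_small_uniformly:
  assumes U: "\<And>m. U m \<in> sets borel" "incseq U" "(\<Union>m. U m) = UNIV" and \<eta>: "\<eta> > 0"
    and tail: "\<And>n. n > n\<^sub>0 \<Longrightarrow> measure (P n) (- U m\<^sub>0) \<le> \<eta>"
  shows "\<exists>m. \<forall>n\<ge>1. measure (P n) (- U m) \<le> \<eta>"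
proof -
  obtain m where m: "\<And>n. n \<ge> 1 \<Longrightarrow> measure (P n) (- U (m n)) \<le> \<eta>"
    using single_tail_small[OF _ U \<eta>] by metis
  define M where "M = Max (insert m\<^sub>0 (m ` {..n\<^sub>0}))"
  have up: "measure (P n) (- U M) \<le> measure (P n) (- U k)" if "n \<ge> 1" "k \<le> M" for n k
    using that U(1) incseqD[OF U(2) that(2)] by (intro measure_P_mono) auto
  have "measure (P n) (- U M) \<le> \<eta>" if n: "n \<ge> 1" for n
  proof (cases "n > n\<^sub>0")
    case True
    then show ?thesis using up[OF n, of m\<^sub>0] tail[of n] by (simp add: M_def)
  next
    case False
    then have "m n \<le> M" unfolding M_def by (intro Max_ge) auto
    then show ?thesis using up[OF n, of "m n"] m[OF n] by simp
  qed
  then show ?thesis by blast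
qed

text \<open>
  A Dini argument: the increasing open sets \<open>U m\<close> cover a compact set of large mass, so one of them
  contains it.
\<close>

lemma tail_small_of_tight:
  assumes tight: "\<And>e. e > 0 \<Longrightarrow> \<exists>K. compact K \<and> (\<forall>n\<ge>1. measure (P n) K > 1 - e)"
    and U: "\<And>m. open (U m)" "incseq U" "(\<Union>m. U m) = UNIV" and \<eta>: "\<eta> > 0"
  shows "\<exists>m. \<forall>n\<ge>1. measure (P n) (- U m) \<le> \<eta>"
proof -
  obtain K where K: "compact K" "\<And>n. n \<ge> 1 \<Longrightarrow> measure (P n) K > 1 - \<eta>" using tight[OF \<eta>] by blast
  obtain I where I: "finite I" "K \<subseteq> (\<Union>m\<in>I. U m)"
    using compactE_image[OF K(1), of UNIV U] U(1,3) by auto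
  have "U m \<subseteq> U (Max (insert 0 I))" if "m \<in> I" for m
    using that I(1) by (intro incseqD[OF U(2)]) simp
  then have KU: "K \<subseteq> U (Max (insert 0 I))" using I(2) by blast
  have "measure (P n) (- U (Max (insert 0 I))) \<le> \<eta>" if n: "n \<ge> 1" for n
  proof -
    have "measure (P n) K \<le> measure (P n) (U (Max (insert 0 I)))"
      using U(1) KU by (intro measure_P_mono[OF n]) auto
    then show ?thesis using K(2)[OF n] measure_P_compl[OF n, of "U (Max (insert 0 I))"] U(1) by simp
  qed
  then show ?thesis by blast
qed

end

text \<open>
  A fixed sequence of scales tending to \<open>0\<close>. It starts at \<open>1/2\<close>, since sparse sets exist for scales
  below \<open>1\<close> only.
\<close>

definition modulus_scale :: "nat \<Rightarrow> real" where
  "modulus_scale m = inverse (real (Suc (Suc m)))"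

lemma modulus_scale: "0 < modulus_scale m" "modulus_scale m < 1"
  by (auto simp: modulus_scale_def field_simps)

lemma modulus_scale_antimono: "m \<le> m' \<Longrightarrow> modulus_scale m' \<le> modulus_scale m"
  by (auto simp: modulus_scale_def field_simps)

lemma filterlim_modulus_scale: "filterlim modulus_scale (at_right 0) sequentially"
proof -
  have "modulus_scale \<longlonglongrightarrow> 0"
    using LIMSEQ_Suc[OF LIMSEQ_inverse_real_of_nat] by (simp add: modulus_scale_def[abs_def])
  then show ?thesis
    by (rule tendsto_imp_filterlim_at_right) (simp add: modulus_scale)
qed

lemma modulus_scale_le:
  assumes "\<delta> > 0"
  shows "\<exists>m. modulus_scale m \<le> \<delta>"
proof -
  obtain n where n: "inverse (real (Suc n)) < \<delta>" using reals_Archimedean[OF assms] by blast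
  have "modulus_scale n \<le> inverse (real (Suc n))" by (simp add: modulus_scale_def field_simps)
  then show ?thesis using n by (intro exI[of _ n]) simp
qed

lemma modulus_sets_cover:
  assumes "e > 0"
  shows "incseq (\<lambda>m. {x. cadlag_modulus x (modulus_scale m) < e})"
    "(\<Union>m. {x. cadlag_modulus x (modulus_scale m) < e}) = UNIV"
proof -
  show "incseq (\<lambda>m. {x. cadlag_modulus x (modulus_scale m) < e})"
  proof (rule incseq_SucI, rule subsetI)
    fix m x assume "x \<in> {x. cadlag_modulus x (modulus_scale m) < e}"
    then show "x \<in> {x. cadlag_modulus x (modulus_scale (Suc m)) < e}"
      using cadlag_modulus_mono[OF modulus_scale_antimono[of m "Suc m"] modulus_scale(2), of x] by simp
  qed
  have "\<exists>m. cadlag_modulus x (modulus_scale m) < e" for x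
  proof -
    obtain \<delta> where d: "0 < \<delta>" "\<delta> < 1" "cadlag_modulus x \<delta> < e"
      using cadlag_modulus_small_at_fine_scale[OF assms, of x] by auto
    obtain m where "modulus_scale m \<le> \<delta>" using modulus_scale_le[OF d(1)] by blast
    from cadlag_modulus_mono[OF this d(2), of x] d(3) show ?thesis by (intro exI[of _ m]) simp
  qed
  then show "(\<Union>m. {x. cadlag_modulus x (modulus_scale m) < e}) = UNIV" by auto
qed

lemma sup_norm_sets_cover:
  "incseq (\<lambda>m. {x. sup_norm x < real m})" "(\<Union>m. {x. sup_norm x < real m}) = UNIV"
proof -
  show "incseq (\<lambda>m. {x. sup_norm x < real m})" by (auto simp: incseq_def)
  have "\<exists>m. sup_norm x < real m" for x by (rule reals_Archimedean2)
  then show "(\<Union>m. {x. sup_norm x < real m}) = UNIV" by auto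
qed

text \<open>
  Choose thresholds such that the events \<open>sup_norm x \<ge> M\<close> and \<open>cadlag_modulus x (modulus_scale (m k)) \<ge> 1/(k+1)\<close>
  have probabilities at most \<open>e/4\<close> and \<open>e/4 * 2^-(k+1)\<close> for all \<open>n\<close>. Off their union, which has mass
  at most \<open>e/2\<close>, the paths form a relatively compact set.
\<close>

lemma tight_of_tail_small:
  fixes P :: "nat \<Rightarrow> cadlag measure"
  assumes P: "borel_prob_sequence P"
    and norm: "\<And>\<eta>. \<eta> > 0 \<Longrightarrow> \<exists>m. \<forall>n\<ge>1. measure (P n) (- {x. sup_norm x < real m}) \<le> \<eta>"
    and modulus: "\<And>e \<eta>. e > 0 \<Longrightarrow> \<eta> > 0 \<Longrightarrow>
      \<exists>m. \<forall>n\<ge>1. measure (P n) (- {x. cadlag_modulus x (modulus_scale m) < e}) \<le> \<eta>"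
  shows "tight_sequence P"
  unfolding tight_sequence_def
proof (intro allI impI)
  fix e :: real assume e: "e > 0"
  interpret borel_prob_sequence P by (rule P)
  obtain M where M: "\<And>n. n \<ge> 1 \<Longrightarrow> measure (P n) (- {x. sup_norm x < real M}) \<le> e / 4"
    using norm[of "e / 4"] e by auto
  have "\<exists>m. \<forall>n\<ge>1. measure (P n) (- {x. cadlag_modulus x (modulus_scale m) < inverse (real (Suc k))})
      \<le> e / 4 * (1 / 2) ^ Suc k" for k
    using e by (intro modulus) auto
  then obtain m where m: "\<And>k n. n \<ge> 1 \<Longrightarrow>
      measure (P n) (- {x. cadlag_modulus x (modulus_scale (m k)) < inverse (real (Suc k))})
      \<le> e / 4 * (1 / 2) ^ Suc k"
    by metis
  define B where "B k = - {x. cadlag_modulus x (modulus_scale (m k)) < inverse (real (Suc k))}" for k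
  define A where "A = {x. sup_norm x < real M \<and>
    (\<forall>k. cadlag_modulus x (modulus_scale (m k)) < inverse (real (Suc k)))}"
  have "compact (closure A)"
    unfolding A_def
    by (rule compact_closure_bounded_modulus[OF modulus_scale LIMSEQ_inverse_real_of_nat])
  moreover have "measure (P n) (closure A) > 1 - e" if n: "n \<ge> 1" for n
  proof -
    interpret prob_space "P n" by (rule prob[OF n])
    have meas: "- {x. sup_norm x < real M} \<in> sets (P n)" "range B \<subseteq> sets (P n)"
      using open_sup_norm_less open_cadlag_modulus_less[OF modulus_scale(2)] sets_P[OF n]
      by (auto simp: B_def)
    have sums: "(\<lambda>k. e / 4 * (1 / 2) ^ Suc k) sums (e / 4 * 1)"
      by (rule sums_mult[OF power_half_series])
    have summable: "summable (\<lambda>k. measure (P n) (B k))"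
      by (rule summable_comparison_test'[OF sums_summable[OF sums], of 0])
        (use m[OF n] in \<open>simp add: B_def\<close>)
    have "measure (P n) (\<Union>k. B k) \<le> (\<Sum>k. measure (P n) (B k))"
      by (rule finite_measure_subadditive_countably[OF meas(2) summable])
    also have "\<dots> \<le> (\<Sum>k. e / 4 * (1 / 2) ^ Suc k)"
      using m[OF n] by (intro suminf_le[OF _ summable sums_summable[OF sums]]) (simp add: B_def)
    also have "\<dots> = e / 4" using sums_unique[OF sums] by simp
    finally have B: "measure (P n) (\<Union>k. B k) \<le> e / 4" .
    have "- closure A \<subseteq> - {x. sup_norm x < real M} \<union> (\<Union>k. B k)"
      using closure_subset[of A] by (auto simp: A_def B_def)
    then have "measure (P n) (- closure A) \<le> measure (P n) (- {x. sup_norm x < real M} \<union> (\<Union>k. B k))"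
      using meas by (intro finite_measure_mono) auto
    also have "\<dots> \<le> measure (P n) (- {x. sup_norm x < real M}) + measure (P n) (\<Union>k. B k)"
      using meas by (intro measure_Un_le) auto
    also have "\<dots> \<le> e / 4 + e / 4" using M[OF n] B by (rule add_mono)
    finally show ?thesis using measure_P_compl[OF n, of "closure A"] e by simp
  qed
  ultimately show "\<exists>K. compact K \<and> (\<forall>n\<ge>1. measure (P n) K > 1 - e)" by blast
qed

theorem theorem7p11:
  fixes P :: "nat \<Rightarrow> cadlag measure"
  assumes "\<And>n. n \<ge> 1 \<Longrightarrow> prob_space (P n)"
    and "\<And>n. n \<ge> 1 \<Longrightarrow> sets (P n) = sets borel"
  shows
    "(tight_sequence P \<longleftrightarrow>
        ((\<lambda>a::real. limsup (\<lambda>n. ereal (measure (P n) {x. sup_norm x \<ge> a}))) \<longlongrightarrow> 0) at_top \<and>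
        (\<forall>\<epsilon>>0. ((\<lambda>\<delta>. limsup (\<lambda>n. ereal (measure (P n) {x. cadlag_modulus x \<delta> \<ge> \<epsilon>}))) \<longlongrightarrow> 0) (at_right 0)))
     \<and>
     ((\<forall>\<epsilon>>0. ((\<lambda>\<delta>. limsup (\<lambda>n. ereal (measure (P n) {x. cadlag_modulus x \<delta> \<ge> \<epsilon>}))) \<longlongrightarrow> 0) (at_right 0))
      \<longleftrightarrow>
      (\<forall>\<epsilon>>0. \<forall>\<eta>>0. \<exists>\<delta>\<in>{0<..<1}. \<exists>n\<^sub>0>0. \<forall>n>n\<^sub>0.
          measure (P n) {x. cadlag_modulus x \<delta> \<ge> \<epsilon>} \<le> \<eta>))"
    (is "(_ \<longleftrightarrow> ?i \<and> ?ii) \<and> (_ \<longleftrightarrow> ?ii')")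
proof -
  interpret borel_prob_sequence P by (rule borel_prob_sequence.intro) (fact assms)+
  have norm_compl: "{x. sup_norm x \<ge> a} = - {x. sup_norm x < a}" for a by auto
  have mod_compl: "{x. cadlag_modulus x \<delta> \<ge> e} = - {x. cadlag_modulus x \<delta> < e}" for \<delta> e by auto
  have mod_borel: "{x. cadlag_modulus x \<delta> \<ge> e} \<in> sets borel" if "\<delta> < 1" for \<delta> e
    unfolding mod_compl using open_cadlag_modulus_less[OF that] by auto
  \<comment> \<open>Both limit conditions become tail bounds along a sequence of parameters.\<close>
  have i: "?i \<longleftrightarrow> (\<forall>\<eta>>0. \<exists>m n\<^sub>0. \<forall>n>n\<^sub>0. measure (P n) {x. sup_norm x \<ge> real m} \<le> \<eta>)"
  proof (rule limsup_tendsto_zero_iff_along)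
    show "filterlim real at_top sequentially" by (rule filterlim_real_sequentially)
    show "\<forall>\<^sub>F a in at_top. {x. sup_norm x \<ge> a} \<subseteq> {x. sup_norm x \<ge> real m}" for m
      using eventually_ge_at_top[of "real m"] by eventually_elim auto
    show "{x. sup_norm x \<ge> real m} \<in> sets borel" for m
      unfolding norm_compl using open_sup_norm_less by auto
  qed
  have ii_e: "((\<lambda>\<delta>. limsup (\<lambda>n. ereal (measure (P n) {x. cadlag_modulus x \<delta> \<ge> \<epsilon>}))) \<longlongrightarrow> 0) (at_right 0)
      \<longleftrightarrow> (\<forall>\<eta>>0. \<exists>m n\<^sub>0. \<forall>n>n\<^sub>0. measure (P n) {x. cadlag_modulus x (modulus_scale m) \<ge> \<epsilon>} \<le> \<eta>)" for \<epsilon>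
  proof (rule limsup_tendsto_zero_iff_along[OF filterlim_modulus_scale])
    show "\<forall>\<^sub>F \<delta> in at_right 0. {x. cadlag_modulus x \<delta> \<ge> \<epsilon>} \<subseteq> {x. cadlag_modulus x (modulus_scale m) \<ge> \<epsilon>}" for m
      using modulus_scale(1)[of m] cadlag_modulus_mono[OF _ modulus_scale(2)]
      by (intro eventually_at_rightI[of 0 "modulus_scale m"]) (auto intro: order_trans less_imp_le)
    show "{x. cadlag_modulus x (modulus_scale m) \<ge> \<epsilon>} \<in> sets borel" for m
      by (rule mod_borel[OF modulus_scale(2)])
  qed
  have ii: "?ii \<longleftrightarrow> (\<forall>\<epsilon>>0. \<forall>\<eta>>0. \<exists>m n\<^sub>0. \<forall>n>n\<^sub>0.
      measure (P n) {x. cadlag_modulus x (modulus_scale m) \<ge> \<epsilon>} \<le> \<eta>)"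
    unfolding ii_e by blast
  have "tight_sequence P \<longleftrightarrow> ?i \<and> ?ii"
  proof
    assume "tight_sequence P"
    then have tight: "\<And>e. e > 0 \<Longrightarrow> \<exists>K. compact K \<and> (\<forall>n\<ge>1. measure (P n) K > 1 - e)"
      by (simp add: tight_sequence_def)
    have tail: "\<exists>m n\<^sub>0. \<forall>n>n\<^sub>0. measure (P n) (- U m) \<le> \<eta>"
      if U: "\<And>m. open (U m)" "incseq U" "(\<Union>m. U m) = UNIV" "\<eta> > 0" for U \<eta>
    proof -
      obtain m where "\<And>n. n \<ge> 1 \<Longrightarrow> measure (P n) (- U m) \<le> \<eta>"
        using tail_small_of_tight[OF tight U] by blast
      then show ?thesis by (intro exI[of _ m] exI[of _ 0]) simp
    qed
    show "?i \<and> ?ii"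
      unfolding i ii unfolding norm_compl mod_compl
      using tail[OF open_sup_norm_less sup_norm_sets_cover]
        tail[OF open_cadlag_modulus_less[OF modulus_scale(2)] modulus_sets_cover] by simp
  next
    assume lim: "?i \<and> ?ii"
    show "tight_sequence P"
    proof (rule tight_of_tail_small)
      show "borel_prob_sequence P" by unfold_locales
      show "\<exists>m. \<forall>n\<ge>1. measure (P n) (- {x. sup_norm x < real m}) \<le> \<eta>" if pos: "\<eta> > 0" for \<eta>
      proof -
        obtain m n\<^sub>0 where "\<And>n. n > n\<^sub>0 \<Longrightarrow> measure (P n) (- {x. sup_norm x < real m}) \<le> \<eta>"
          using lim pos unfolding i unfolding norm_compl by blast
        from tail_small_uniformly[OF _ sup_norm_sets_cover pos this] show ?thesis
          using open_sup_norm_less by simp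
      qed
      show "\<exists>m. \<forall>n\<ge>1. measure (P n) (- {x. cadlag_modulus x (modulus_scale m) < e}) \<le> \<eta>"
        if pos: "e > 0" "\<eta> > 0" for e \<eta>
      proof -
        obtain m n\<^sub>0 where "\<And>n. n > n\<^sub>0 \<Longrightarrow> measure (P n) (- {x. cadlag_modulus x (modulus_scale m) < e}) \<le> \<eta>"
          using lim pos unfolding ii unfolding mod_compl by blast
        from tail_small_uniformly[OF _ modulus_sets_cover[OF pos(1)] pos(2) this] show ?thesis
          using open_cadlag_modulus_less[OF modulus_scale(2)] by simp
      qed
    qed
  qed
  moreover have "?ii \<longleftrightarrow> ?ii'"
    unfolding ii
  proof (intro iffI allI impI)
    fix \<epsilon> \<eta> :: real assume "\<epsilon> > 0" "\<eta> > 0"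
    moreover assume "\<forall>\<epsilon>>0. \<forall>\<eta>>0. \<exists>m n\<^sub>0. \<forall>n>n\<^sub>0.
      measure (P n) {x. cadlag_modulus x (modulus_scale m) \<ge> \<epsilon>} \<le> \<eta>"
    ultimately obtain m n\<^sub>0 where
      "\<And>n. n > n\<^sub>0 \<Longrightarrow> measure (P n) {x. cadlag_modulus x (modulus_scale m) \<ge> \<epsilon>} \<le> \<eta>" by blast
    then show "\<exists>\<delta>\<in>{0<..<1}. \<exists>n\<^sub>0>0. \<forall>n>n\<^sub>0. measure (P n) {x. cadlag_modulus x \<delta> \<ge> \<epsilon>} \<le> \<eta>"
      using modulus_scale by (intro bexI[of _ "modulus_scale m"] exI[of _ "Suc n\<^sub>0"]) auto
  next
    fix \<epsilon> \<eta> :: real assume "\<epsilon> > 0" "\<eta> > 0"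
    moreover assume ?ii'
    ultimately obtain \<delta> n\<^sub>0 where d: "0 < \<delta>" "\<delta> < 1"
      "\<And>n. n > n\<^sub>0 \<Longrightarrow> measure (P n) {x. cadlag_modulus x \<delta> \<ge> \<epsilon>} \<le> \<eta>"
      by (metis greaterThanLessThan_iff)
    obtain m where m: "modulus_scale m \<le> \<delta>" using modulus_scale_le[OF d(1)] by blast
    have "measure (P n) {x. cadlag_modulus x (modulus_scale m) \<ge> \<epsilon>} \<le> \<eta>" if "n > n\<^sub>0" for n
    proof -
      have "{x. cadlag_modulus x (modulus_scale m) \<ge> \<epsilon>} \<subseteq> {x. cadlag_modulus x \<delta> \<ge> \<epsilon>}"
        using cadlag_modulus_mono[OF m d(2)] order_trans by blast
      then have "measure (P n) {x. cadlag_modulus x (modulus_scale m) \<ge> \<epsilon>}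
          \<le> measure (P n) {x. cadlag_modulus x \<delta> \<ge> \<epsilon>}"
        using that by (intro measure_P_mono mod_borel[OF d(2)]) auto
      then show ?thesis using d(3)[OF that] by simp
    qed
    then show "\<exists>m n\<^sub>0. \<forall>n>n\<^sub>0. measure (P n) {x. cadlag_modulus x (modulus_scale m) \<ge> \<epsilon>} \<le> \<eta>" by blast
  qed
  ultimately show ?thesis by blast
qed

end
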